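(* Let $\mathfrak{p}\subset V$ be a polytope and $\xi\in V^*_{\mathbb{C}}$. Then, modulo the span of indicator functions of polyhedra containing a line, $$[\mathfrak{p}]\equiv\sum_{\mathfrak{g}\in\{\mathfrak{p}\}_\xi}[\mathfrak{g}^{\mathfrak{g}}]\times\mathrm{LC}^{\mathfrak{p}}_{\mathfrak{g}}(\xi).$$
   Context: $V$ is a real finite-dimensional inner product space; $P_W$ is orthogonal projection onto a subspace $W$. For a face $\mathfrak{f}$ of a polyhedron $\mathfrak{q}$: $\mathrm{lin}(\mathfrak{f})$ is the linear subspace parallel to the affine hull of $\mathfrak{f}$; for any set $S$, $S^{\mathfrak{f}}:=P_{\mathrm{lin}(\mathfrak{f})}(S)$, $S^{\mathfrak{f}^\perp}:=P_{\mathrm{lin}(\mathfrak{f})^\perp}(S)$. Tangent cone $\mathfrak{s}^{\mathfrak{q}}_{\mathfrak{f}}=\{x+w:x+\varepsilon w\in\mathfrak{q}\text{ for small }\varepsilon>0\}$ ($x$ in the relative interior of $\mathfrak{f}$); transverse cone $\mathfrak{t}^{\mathfrak{q}}_{\mathfrak{f}}:=P_{\mathrm{lin}(\mathfrak{f})^\perp}(\mathfrak{s}^{\mathfrak{q}}_{\mathfrak{f}})$, pointed with vertex $\mathfrak{f}^{\mathfrak{f}^\perp}$; ${}^0\mathfrak{k}$ is the translate of a cone $\mathfrak{k}$ with vertex at $0$. A face is $\xi$-constant if $\langle\xi,\cdot\rangle$ is constant on it; $\{\mathfrak{p}\}_\xi$ is the set of $\xi$-constant faces. Virtual polyhedra are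 finite real linear combinations of indicator functions $[\mathfrak{q}]$; $\equiv$ means equality modulo the subspace spanned by indicators of polyhedra containing a line; products refer to orthogonal direct sums, $[\mathfrak{q}_1]\times[\mathfrak{q}_2]=[\mathfrak{q}_1\times\mathfrak{q}_2]$. Shifted alternating Levi cone: ${}^0\mathrm{LC}^{\mathfrak{p}}_{\mathfrak{g}}(\xi):=\sum(-1)^\ell[{}^0\mathfrak{t}^{\mathfrak{h}_1}_{\mathfrak{g}}\times{}^0\mathfrak{t}^{\mathfrak{h}_2}_{\mathfrak{h}_1}\times\cdots\times{}^0\mathfrak{t}^{\mathfrak{h}_\ell}_{\mathfrak{h}_{\ell-1}}\times{}^0\mathfrak{t}^{\mathfrak{p}}_{\mathfrak{h}_\ell}]$ over all chains $\mathfrak{g}=\mathfrak{h}_0\subsetneq\cdots\subsetneq\mathfrak{h}_\ell$ ($\ell\ge0$) of $\xi$-constant faces, a virtual cone in $\mathrm{lin}(\mathfrak{g})^\perp$ (products taken in the orthogonal decomposition $\mathrm{lin}(\mathfrak{g})^\perp=\bigoplus_j(\mathrm{lin}(\mathfrak{h}_j)^\perp\cap\mathrm{lin}(\mathfrak{h}_{j+1}))\oplus\mathrm{lin}(\mathfrak{h}_\ell)^\perp$); $\mathrm{LC}^{\mathfrak{p}}_{\mathfrak{g}}(\xi):=\mathfrak{g}^{\mathfrak{g}^\perp}+{}^0\mathrm{LC}^{\mathfrak{p}}_{\mathfrak{g}}(\xi)$. *)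

theory Defs
  imports "HOL-Analysis.Analysis"
begin

definition orth_compl :: "'a::real_inner set \<Rightarrow> 'a set" where
  "orth_compl W = {y. \<forall>w\<in>W. inner y w = 0}"

definition oproj :: "'a::real_inner set \<Rightarrow> 'a \<Rightarrow> 'a" where
  "oproj W x = (THE y. y \<in> W \<and> (\<forall>w\<in>W. inner (x - y) w = 0))"

definition lin :: "'a::real_vector set \<Rightarrow> 'a set" where
  "lin f = {x - y | x y. x \<in> affine hull f \<and> y \<in> affine hull f}"

definition proj_par :: "'a::euclidean_space set \<Rightarrow> 'a set \<Rightarrow> 'a set" where
  "proj_par f S = oproj (lin f) ` S"

definition proj_perp :: "'a::euclidean_space set \<Rightarrow> 'a set \<Rightarrow> 'a set" where
  "proj_perp f S = oproj (orth_compl (lin f)) ` S"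

definition tangent_cone :: "'a::euclidean_space set \<Rightarrow> 'a set \<Rightarrow> 'a set" where
  "tangent_cone q f =
     (let x = (SOME x. x \<in> rel_interior f) in
      {x + w | w. \<forall>\<^sub>F \<epsilon> in at_right (0::real). x + \<epsilon> *\<^sub>R w \<in> q})"

definition transverse_cone :: "'a::euclidean_space set \<Rightarrow> 'a set \<Rightarrow> 'a set" where
  "transverse_cone q f = proj_perp f (tangent_cone q f)"

definition perp_vertex :: "'a::euclidean_space set \<Rightarrow> 'a" where
  "perp_vertex f = (THE v. proj_perp f f = {v})"

definition transverse_cone0 :: "'a::euclidean_space set \<Rightarrow> 'a set \<Rightarrow> 'a set" where
  "transverse_cone0 q f = (\<lambda>y. y - perp_vertex f) ` transverse_cone q f"

text \<open>Faces are nonempty faces; xi is a real-linear functional V \<rightarrow> C.\<close>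
definition xi_const_face :: "'a::euclidean_space set \<Rightarrow> ('a \<Rightarrow> complex) \<Rightarrow> 'a set \<Rightarrow> bool" where
  "xi_const_face p \<xi> g \<longleftrightarrow> g face_of p \<and> g \<noteq> {} \<and> (\<exists>c. \<forall>x\<in>g. \<xi> x = c)"

definition xi_chains :: "'a::euclidean_space set \<Rightarrow> ('a \<Rightarrow> complex) \<Rightarrow> 'a set \<Rightarrow> 'a set list set" where
  "xi_chains p \<xi> g = {hs. hs \<noteq> [] \<and> hd hs = g \<and> sorted_wrt (\<subset>) hs \<and>
                          (\<forall>h\<in>set hs. xi_const_face p \<xi> h)}"

fun chain_cones :: "'a::euclidean_space set \<Rightarrow> 'a set list \<Rightarrow> 'a set list" where
  "chain_cones p [] = []"
| "chain_cones p [h] = [transverse_cone0 p h]"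
| "chain_cones p (h # h' # hs) = transverse_cone0 h' h # chain_cones p (h' # hs)"

text \<open>Product of sets lying in mutually orthogonal subspaces, realised inside V
  (the orthogonal direct sum) as the Minkowski sum.\<close>
fun msum :: "'a::real_vector set list \<Rightarrow> 'a set" where
  "msum [] = {0}"
| "msum (A # As) = {a + b | a b. a \<in> A \<and> b \<in> msum As}"

text \<open>Virtual polyhedra are real-valued functions on V.\<close>
definition shifted_LC :: "'a::euclidean_space set \<Rightarrow> ('a \<Rightarrow> complex) \<Rightarrow> 'a set \<Rightarrow> 'a \<Rightarrow> real" where
  "shifted_LC p \<xi> g = (\<lambda>y. \<Sum>hs\<in>xi_chains p \<xi> g.
       (-1) ^ (length hs - 1) * indicator (msum (chain_cones p hs)) y)"

definition LC :: "'a::euclidean_space set \<Rightarrow> ('a \<Rightarrow> complex) \<Rightarrow> 'a set \<Rightarrow> 'a \<Rightarrow> real" where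
  "LC p \<xi> g = (\<lambda>y. shifted_LC p \<xi> g (y - perp_vertex g))"

text \<open>Product [A] x F of a set A in lin(g) with a virtual polyhedron F in lin(g)^perp,
  in V = lin(g) \<oplus> lin(g)^perp.\<close>
definition vprod_face :: "'a::euclidean_space set \<Rightarrow> 'a set \<Rightarrow> ('a \<Rightarrow> real) \<Rightarrow> 'a \<Rightarrow> real" where
  "vprod_face g A F = (\<lambda>x. indicator A (oproj (lin g) x) * F (oproj (orth_compl (lin g)) x))"

definition contains_line :: "'a::real_vector set \<Rightarrow> bool" where
  "contains_line q \<longleftrightarrow> (\<exists>x v. v \<noteq> 0 \<and> (\<forall>t::real. x + t *\<^sub>R v \<in> q))"

definition vequiv :: "('a::euclidean_space \<Rightarrow> real) \<Rightarrow> ('a \<Rightarrow> real) \<Rightarrow> bool" where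
  "vequiv F G \<longleftrightarrow> (\<exists>(I::nat set) c Q. finite I \<and>
      (\<forall>i\<in>I. polyhedron (Q i) \<and> contains_line (Q i)) \<and>
      (\<forall>x. F x - G x = (\<Sum>i\<in>I. c i * indicator (Q i) x)))"

end

theory Submission
  imports Defs
begin

text \<open>
  Brion's theorem states that a polytope is equivalent to the sum of its tangent cones at the vertices.
  It is derived from an exact identity: if \<open>V\<close> is a finite nonempty set, then the indicator of
  \<open>conv V\<close> is the alternating sum, over the nonempty \<open>S \<subseteq> V\<close>, of the indicators of the tangent cones of
  \<open>conv V\<close> at the barycentres of \<open>S\<close>, and these cones contain a line as soon as \<open>S\<close> has two elements.

  The right-hand side of the theorem is an alternating sum over chains
  \<open>g = h\<^sub>0 \<subset> \<dots> \<subset> h\<^sub>l\<close>. If \<open>g\<close> is not a vertex, Brion's theorem for \<open>g\<close> replaces the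
  factor \<open>[g]\<close> by the sum of the tangent cones of \<open>g\<close> at its vertices \<open>v\<close>, which gives the terms of the
  chains \<open>{v} \<subset> h\<^sub>0 \<subset> \<dots> \<subset> h\<^sub>l\<close> with the opposite sign. Everything cancels except for the chains
  consisting of a single vertex of \<open>p\<close>, and their terms add up to \<open>[p]\<close> by Brion's theorem for \<open>p\<close>.
\<close>

subsection \<open>The Euler characteristic of compact convex sets\<close>

text \<open>Passing from \<open>t\<close> to a point slightly to its right, the indicator of a
  nonempty compact interval drops by 1 if \<open>t\<close> is its right endpoint and is unchanged
  otherwise. A relation between indicators therefore makes the coefficients of the intervals with a
  given right endpoint sum to zero, and adding over the endpoints gives the claim.\<close>

lemma euler_relation_intervals:
  fixes K :: "'i \<Rightarrow> real set" and c :: "'i \<Rightarrow> real"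
  assumes fin: "finite I" and K: "\<And>i. i \<in> I \<Longrightarrow> compact (K i) \<and> convex (K i)"
    and zero: "\<And>t. (\<Sum>i\<in>I. c i * indicator (K i) t) = 0"
  shows "(\<Sum>i\<in>{i\<in>I. K i \<noteq> {}}. c i) = 0"
proof -
  define J where "J = {i\<in>I. K i \<noteq> {}}"
  define m where "m i = Sup (K i)" for i
  have finJ: "finite J" using fin by (simp add: J_def)
  have jump: "\<forall>\<^sub>F s in at_right t. indicator (K i) t - indicator (K i) s = (of_bool (m i = t) :: real)"
    if i: "i \<in> J" for i t
  proof -
    have "connected (K i)" "compact (K i)" "K i \<noteq> {}"
      using i K by (auto simp: J_def convex_connected)
    then obtain a b where ab: "K i = {a..b}" "a \<le> b"
      by (metis atLeastatMost_empty_iff connected_compact_interval_1 box_real(2))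
    have mb: "m i = b" using ab by (simp add: m_def)
    consider "t < a" | "a \<le> t" "t < b" | "b \<le> t" by linarith
    then show ?thesis
    proof cases
      case 1
      have "\<forall>\<^sub>F s in at_right t. s < a"
        using 1 eventually_at_right_less eventually_at_right_real[OF 1] by (auto elim: eventually_mono)
      then show ?thesis by eventually_elim (use 1 ab mb in \<open>auto simp: indicator_def\<close>)
    next
      case 2
      have "\<forall>\<^sub>F s in at_right t. s \<in> {t<..<b}"
        using 2 eventually_at_right_real by auto
      then show ?thesis by eventually_elim (use 2 ab mb in \<open>auto simp: indicator_def\<close>)
    next
      case 3
      have "\<forall>\<^sub>F s in at_right t. t < s" by (simp add: eventually_at_right_less)
      then show ?thesis by eventually_elim (use 3 ab mb in \<open>auto simp: indicator_def\<close>)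
    qed
  qed
  have zeroJ: "(\<Sum>i\<in>J. c i * indicator (K i) t) = 0" for t
  proof -
    have "(\<Sum>i\<in>J. c i * indicator (K i) t) = (\<Sum>i\<in>I. c i * indicator (K i) t)"
      using fin by (intro sum.mono_neutral_left) (auto simp: J_def)
    then show ?thesis using zero by simp
  qed
  have level: "(\<Sum>i\<in>{i\<in>J. m i = t}. c i) = 0" for t
  proof -
    have "\<forall>\<^sub>F s in at_right t. \<forall>i\<in>J. indicator (K i) t - indicator (K i) s = (of_bool (m i = t) :: real)"
      using finJ jump by (simp add: eventually_ball_finite)
    then obtain s where s: "\<And>i. i \<in> J \<Longrightarrow> indicator (K i) t - indicator (K i) s = (of_bool (m i = t) :: real)"
      using eventually_happens'[OF trivial_limit_at_right_real] by blast
    have "(\<Sum>i\<in>{i\<in>J. m i = t}. c i) = (\<Sum>i\<in>J. c i * of_bool (m i = t))"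
      using finJ by (simp add: sum.inter_filter of_bool_def if_distrib cong: if_cong)
    also have "\<dots> = (\<Sum>i\<in>J. c i * indicator (K i) t) - (\<Sum>i\<in>J. c i * indicator (K i) s)"
      by (simp add: s[symmetric] algebra_simps sum_subtractf)
    finally show ?thesis by (simp add: zeroJ)
  qed
  have "sum c J = (\<Sum>t\<in>m ` J. \<Sum>i\<in>{i\<in>J. m i = t}. c i)"
    using finJ by (rule sum.image_gen)
  then show ?thesis by (simp add: level flip: J_def)
qed

text \<open>Induction on the set \<open>B\<close> of coordinates that may still vary; all others
  agree with those of \<open>z\<close>. By induction the relation holds for the slices at each
  height \<open>t\<close> in direction \<open>b\<close>. A slice is nonempty exactly when
  \<open>t\<close> lies in the projection of \<open>K i\<close>, so the slice relations form the
  hypothesis of the one-dimensional case for the projections.\<close>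

lemma euler_relation_coordinate_flat:
  fixes K :: "'i \<Rightarrow> 'a::euclidean_space set" and c :: "'i \<Rightarrow> real"
  assumes "finite B" "B \<subseteq> Basis" "finite I"
    and "\<And>i. i \<in> I \<Longrightarrow> compact (K i) \<and> convex (K i)"
    and "\<And>i x b. i \<in> I \<Longrightarrow> x \<in> K i \<Longrightarrow> b \<in> Basis - B \<Longrightarrow> x \<bullet> b = z \<bullet> b"
    and "\<And>x. (\<Sum>i\<in>I. c i * indicator (K i) x) = 0"
  shows "(\<Sum>i\<in>{i\<in>I. K i \<noteq> {}}. c i) = 0"
  using assms(1,2,4-)
proof (induction B arbitrary: K z rule: finite_induct)
  case empty
  have "x = z" if "i \<in> I" "x \<in> K i" for i x
    using empty.prems(3)[OF that] by (auto intro: euclidean_eq_iff[THEN iffD2])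
  then have "K i \<noteq> {} \<longleftrightarrow> z \<in> K i" if "i \<in> I" for i
    using that by blast
  then have "(\<Sum>i\<in>{i\<in>I. K i \<noteq> {}}. c i) = (\<Sum>i\<in>I. if z \<in> K i then c i else 0)"
    by (subst sum.inter_filter[OF assms(3), symmetric]) (rule sum.cong, auto)
  also have "\<dots> = (\<Sum>i\<in>I. c i * indicator (K i) z)"
    by (rule sum.cong) (auto simp: indicator_def)
  finally show ?case using empty.prems(4) by simp
next
  case (insert b B)
  let ?H = "\<lambda>t. {x. b \<bullet> x = t}"
  have slice: "(\<Sum>i\<in>{i\<in>I. K i \<inter> ?H t \<noteq> {}}. c i) = 0" for t
  proof (rule insert.IH)
    show "B \<subseteq> Basis" using insert.prems by auto
    show "compact (K i \<inter> ?H t) \<and> convex (K i \<inter> ?H t)" if "i \<in> I" for i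
      using insert.prems(2)[OF that]
      by (simp add: compact_Int_closed convex_Int convex_hyperplane closed_hyperplane)
    \<comment> \<open>The base point is moved along \<open>b\<close> to height \<open>t\<close>, so
      that it also records the coordinate fixed by the slice.\<close>
    show "x \<bullet> b' = (z + (t - z \<bullet> b) *\<^sub>R b) \<bullet> b'"
      if "i \<in> I" "x \<in> K i \<inter> ?H t" "b' \<in> Basis - B" for i x b'
    proof (cases "b' = b")
      case True
      then show ?thesis using that insert.prems(1) by (simp add: inner_commute inner_simps)
    next
      case False
      then show ?thesis using that insert.prems(1) insert.prems(3)[OF that(1), of x b']
        by (simp add: inner_simps inner_Basis)
    qed
    show "(\<Sum>i\<in>I. c i * indicator (K i \<inter> ?H t) x) = 0" for x
      using insert.prems(4)[of x]
      by (cases "b \<bullet> x = t") (auto simp: indicator_def cong: sum.cong)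
  qed
  have "(\<Sum>i\<in>{i\<in>I. ((\<bullet>) b) ` K i \<noteq> {}}. c i) = 0"
  proof (rule euler_relation_intervals[OF \<open>finite I\<close>])
    show "compact (((\<bullet>) b) ` K i) \<and> convex (((\<bullet>) b) ` K i)" if "i \<in> I" for i
      using insert.prems(2)[OF that]
      by (auto intro!: compact_continuous_image continuous_intros convex_linear_image
               bounded_linear.linear bounded_linear_inner_right)
    show "(\<Sum>i\<in>I. c i * indicator (((\<bullet>) b) ` K i) t) = 0" for t
    proof -
      have "(\<Sum>i\<in>I. c i * indicator (((\<bullet>) b) ` K i) t)
          = (\<Sum>i\<in>I. if K i \<inter> ?H t \<noteq> {} then c i else 0)"
        by (rule sum.cong) (auto simp: indicator_def)
      then show ?thesis using slice[of t] by (simp add: sum.inter_filter[OF \<open>finite I\<close>])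
    qed
  qed
  then show ?case by simp
qed

lemma euler_relation_compact_convex:
  fixes K :: "'i \<Rightarrow> 'a::euclidean_space set" and c :: "'i \<Rightarrow> real"
  assumes "finite I" "\<And>i. i \<in> I \<Longrightarrow> compact (K i) \<and> convex (K i)"
    and "\<And>x. (\<Sum>i\<in>I. c i * indicator (K i) x) = 0"
  shows "(\<Sum>i\<in>{i\<in>I. K i \<noteq> {}}. c i) = 0"
  by (rule euler_relation_coordinate_flat[where B = Basis]) (use assms in auto)

text \<open>A ball containing one chosen point of each nonempty \<open>K i\<close> reduces this to
  the compact case: truncation by the ball preserves the relation and does not change which sets are
  nonempty.\<close>

lemma euler_relation_closed_convex:
  fixes K :: "'i \<Rightarrow> 'a::euclidean_space set" and c :: "'i \<Rightarrow> real"
  assumes fin: "finite I" and K: "\<And>i. i \<in> I \<Longrightarrow> closed (K i) \<and> convex (K i)"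
    and zero: "\<And>x. (\<Sum>i\<in>I. c i * indicator (K i) x) = 0"
  shows "(\<Sum>i\<in>{i\<in>I. K i \<noteq> {}}. c i) = 0"
proof -
  define y where "y i = (SOME x. x \<in> K i)" for i
  have y: "y i \<in> K i" if "K i \<noteq> {}" for i
    unfolding y_def using that by (simp add: some_in_eq)
  obtain R where R: "\<And>i. i \<in> I \<Longrightarrow> norm (y i) \<le> R"
    using finite_imp_bounded[of "y ` I"] fin by (auto simp: bounded_iff)
  have "(\<Sum>i\<in>{i\<in>I. K i \<inter> cball 0 R \<noteq> {}}. c i) = 0"
  proof (rule euler_relation_compact_convex[OF fin])
    show "compact (K i \<inter> cball 0 R) \<and> convex (K i \<inter> cball 0 R)" if "i \<in> I" for i
      using K[OF that] by (auto intro!: closed_Int_compact convex_Int)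
    show "(\<Sum>i\<in>I. c i * indicator (K i \<inter> cball 0 R) x) = 0" for x
      using zero[of x] by (cases "x \<in> cball 0 R") (auto simp: indicator_def cong: sum.cong)
  qed
  moreover have "{i\<in>I. K i \<inter> cball 0 R \<noteq> {}} = {i\<in>I. K i \<noteq> {}}"
    using y R by fastforce
  ultimately show ?thesis by simp
qed

section \<open>Nerves of convex unions of closed convex sets\<close>

lemma sum_Pow_minus_one_power:
  assumes "finite A"
  shows "(\<Sum>S\<in>Pow A. (- 1) ^ card S) = (of_bool (A = {}) :: real)"
  using prod_diff_conv_sum[OF assms, of "\<lambda>_. 1::real" "\<lambda>_. 1"] assms
  by (cases "A = {}") (simp_all add: card_gt_0_iff power_0_left)

text \<open>At a point \<open>x\<close> of the union, the contributing \<open>S\<close> are the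
  subsets of the nonempty set of all \<open>s\<close> with \<open>x\<close> in \<open>M s\<close>,
  and their signs cancel; the Euler relation then applies. Intersecting with the union matters for
  \<open>S = {}\<close>, whose intersection would otherwise be the whole space.\<close>

lemma nerve_convex_union:
  fixes M :: "'i \<Rightarrow> 'a::euclidean_space set"
  assumes fin: "finite V" and M: "\<And>s. s \<in> V \<Longrightarrow> closed (M s) \<and> convex (M s)"
    and U: "closed (\<Union>(M ` V))" "convex (\<Union>(M ` V))"
  shows "(\<Sum>S\<in>{S\<in>Pow V. \<Union>(M ` V) \<inter> \<Inter>(M ` S) \<noteq> {}}. (- 1) ^ card S) = (0::real)"
proof (rule euler_relation_closed_convex)
  show "finite (Pow V)" using fin by simp
  show "closed (\<Union>(M ` V) \<inter> \<Inter>(M ` S)) \<and> convex (\<Union>(M ` V) \<inter> \<Inter>(M ` S))" if "S \<in> Pow V" for S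
    using that M U by (auto intro!: closed_Int closed_Inter convex_Int convex_Inter)
  show "(\<Sum>S\<in>Pow V. (- 1) ^ card S * indicator (\<Union>(M ` V) \<inter> \<Inter>(M ` S)) x) = (0::real)" for x
  proof (cases "x \<in> \<Union>(M ` V)")
    case True
    let ?X = "{s\<in>V. x \<in> M s}"
    have "(\<Sum>S\<in>Pow V. (- 1) ^ card S * indicator (\<Union>(M ` V) \<inter> \<Inter>(M ` S)) x)
        = (\<Sum>S\<in>Pow ?X. (- 1) ^ card S :: real)"
      using fin True by (intro sum.mono_neutral_cong_right) (auto simp: indicator_def)
    also have "\<dots> = 0" using True fin by (subst sum_Pow_minus_one_power) auto
    finally show ?thesis .
  qed (simp add: indicator_def)
qed

subsection \<open>Cones of feasible directions\<close>

text \<open>For convex \<open>q\<close> containing \<open>y\<close>, one admissible step makes all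
  shorter ones admissible, so this is the cone of \<open>tangent_cone\<close> moved to the origin,
  at a point that can be prescribed.\<close>

definition feasible_dirs :: "'a::real_vector set \<Rightarrow> 'a \<Rightarrow> 'a set" where
  "feasible_dirs q y = {w. \<exists>\<epsilon>>0. y + \<epsilon> *\<^sub>R w \<in> q}"

lemma convex_step_shrink:
  assumes "convex q" "y \<in> q" "y + \<epsilon> *\<^sub>R w \<in> q" "0 \<le> \<delta>" "\<delta> \<le> \<epsilon>"
  shows "y + \<delta> *\<^sub>R w \<in> q"
proof (cases "\<epsilon> = 0")
  case False
  then have "\<epsilon> > 0" using assms by linarith
  have "(1 - \<delta> / \<epsilon>) *\<^sub>R y + (\<delta> / \<epsilon>) *\<^sub>R (y + \<epsilon> *\<^sub>R w) \<in> q"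
    using assms \<open>\<epsilon> > 0\<close> by (intro convexD_alt) auto
  also have "(1 - \<delta> / \<epsilon>) *\<^sub>R y + (\<delta> / \<epsilon>) *\<^sub>R (y + \<epsilon> *\<^sub>R w) = y + \<delta> *\<^sub>R w"
    using \<open>\<epsilon> > 0\<close> by (simp add: algebra_simps)
  finally show ?thesis .
qed (use assms in auto)

lemma eventually_step_iff_feasible:
  assumes "convex q" "y \<in> q"
  shows "(\<forall>\<^sub>F \<epsilon> in at_right (0::real). y + \<epsilon> *\<^sub>R w \<in> q) \<longleftrightarrow> w \<in> feasible_dirs q y"
proof
  assume *: "\<forall>\<^sub>F \<epsilon> in at_right (0::real). y + \<epsilon> *\<^sub>R w \<in> q"
  have "\<forall>\<^sub>F \<epsilon> in at_right (0::real). \<epsilon> > 0 \<and> y + \<epsilon> *\<^sub>R w \<in> q"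
    using eventually_conj[OF eventually_at_right_less *] .
  then show "w \<in> feasible_dirs q y"
    unfolding feasible_dirs_def using eventually_happens'[OF trivial_limit_at_right_real] by blast
next
  assume "w \<in> feasible_dirs q y"
  then obtain \<epsilon> where \<epsilon>: "\<epsilon> > 0" "y + \<epsilon> *\<^sub>R w \<in> q" by (auto simp: feasible_dirs_def)
  from eventually_at_right_real[OF \<epsilon>(1)]
  show "\<forall>\<^sub>F \<epsilon> in at_right (0::real). y + \<epsilon> *\<^sub>R w \<in> q"
    by eventually_elim (use convex_step_shrink[OF assms \<epsilon>(2)] in auto)
qed

lemma feasible_dirs_scale:
  assumes "w \<in> feasible_dirs q y" "t > 0"
  shows "t *\<^sub>R w \<in> feasible_dirs q y"
proof -
  obtain \<epsilon> where "\<epsilon> > 0" "y + \<epsilon> *\<^sub>R w \<in> q" using assms by (auto simp: feasible_dirs_def)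
  then show ?thesis
    using assms(2) unfolding feasible_dirs_def by (intro CollectI exI[of _ "\<epsilon> / t"]) auto
qed

lemma feasible_dirs_add:
  assumes q: "convex q" "y \<in> q" and w: "w \<in> feasible_dirs q y" "w' \<in> feasible_dirs q y"
  shows "w + w' \<in> feasible_dirs q y"
proof -
  obtain \<epsilon> \<epsilon>' where e: "\<epsilon> > 0" "y + \<epsilon> *\<^sub>R w \<in> q" "\<epsilon>' > 0" "y + \<epsilon>' *\<^sub>R w' \<in> q"
    using w by (auto simp: feasible_dirs_def)
  let ?d = "min \<epsilon> \<epsilon>'"
  have "(1 - 1/2) *\<^sub>R (y + ?d *\<^sub>R w) + (1/2) *\<^sub>R (y + ?d *\<^sub>R w') \<in> q"
    using e q by (intro convexD_alt convex_step_shrink[OF q e(2)] convex_step_shrink[OF q e(4)]) auto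
  also have "(1 - 1/2) *\<^sub>R (y + ?d *\<^sub>R w) + (1/2) *\<^sub>R (y + ?d *\<^sub>R w') = y + (?d/2) *\<^sub>R (w + w')"
    by (simp add: algebra_simps flip: scaleR_left_distrib)
  finally show ?thesis
    using e unfolding feasible_dirs_def by (intro CollectI exI[of _ "?d/2"]) auto
qed

lemma diff_in_feasible_dirs: "z \<in> q \<Longrightarrow> z - y \<in> feasible_dirs q y"
  unfolding feasible_dirs_def by (intro CollectI exI[of _ 1]) auto

lemma zero_in_feasible_dirs: "y \<in> q \<Longrightarrow> 0 \<in> feasible_dirs q y"
  using diff_in_feasible_dirs[of y q y] by simp

lemma feasible_dirs_mono: "q \<subseteq> r \<Longrightarrow> feasible_dirs q y \<subseteq> feasible_dirs r y"
  by (auto simp: feasible_dirs_def)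

lemma feasible_dirs_translation: "feasible_dirs ((\<lambda>z. z - a) ` q) (y - a) = feasible_dirs q y"
proof -
  have "y - a + \<epsilon> *\<^sub>R w \<in> (\<lambda>z. z - a) ` q \<longleftrightarrow> y + \<epsilon> *\<^sub>R w \<in> q" for \<epsilon> w
    by (auto simp: image_iff algebra_simps)
  then show ?thesis by (simp add: feasible_dirs_def)
qed

lemma feasible_dirs_subset_subspace:
  assumes "subspace W" "\<And>z. z \<in> q \<Longrightarrow> z - y \<in> W"
  shows "feasible_dirs q y \<subseteq> W"
proof
  fix w assume "w \<in> feasible_dirs q y"
  then obtain \<epsilon> where "\<epsilon> > 0" "y + \<epsilon> *\<^sub>R w \<in> q" by (auto simp: feasible_dirs_def)
  then have "(1/\<epsilon>) *\<^sub>R (\<epsilon> *\<^sub>R w) \<in> W" using assms subspace_scale by fastforce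
  then show "w \<in> W" using \<open>\<epsilon> > 0\<close> by simp
qed

lemma polyhedron_inequalities:
  fixes q :: "'a::euclidean_space set"
  assumes "polyhedron q"
  obtains F :: "'a set set" and a b where "finite F" "\<And>z. z \<in> q \<longleftrightarrow> (\<forall>h\<in>F. a h \<bullet> z \<le> b h)"
proof -
  obtain F where F: "finite F" "q = \<Inter>F" "\<forall>h\<in>F. \<exists>a b. a \<noteq> 0 \<and> h = {x. a \<bullet> x \<le> b}"
    using assms by (auto simp: polyhedron_def)
  then obtain a b where ab: "\<And>h. h \<in> F \<Longrightarrow> h = {x. a h \<bullet> x \<le> b h}" by metis
  have "z \<in> q \<longleftrightarrow> (\<forall>h\<in>F. a h \<bullet> z \<le> b h)" for z
    using ab F(2) by blast
  then show thesis using that F(1) by blast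
qed

text \<open>Only the inequalities that are tight at \<open>y\<close>, collected in \<open>G\<close>,
  restrict the directions. The others have slack that survives a short step, and finiteness gives a
  step that suits all of them.\<close>

lemma polyhedron_feasible_dirs:
  fixes q :: "'a::euclidean_space set"
  assumes "polyhedron q" "y \<in> q"
  shows "polyhedron (feasible_dirs q y)"
proof -
  obtain F :: "'a set set" and a b where F: "finite F" and q: "\<And>z. z \<in> q \<longleftrightarrow> (\<forall>h\<in>F. a h \<bullet> z \<le> b h)"
    using polyhedron_inequalities[OF assms(1)] by blast
  define G where "G = {h\<in>F. a h \<bullet> y = b h}"
  have "feasible_dirs q y = \<Inter>((\<lambda>h. {w. a h \<bullet> w \<le> 0}) ` G)"
  proof (intro equalityI subsetI)
    fix w assume "w \<in> feasible_dirs q y"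
    then obtain \<epsilon> where "\<epsilon> > 0" "y + \<epsilon> *\<^sub>R w \<in> q" by (auto simp: feasible_dirs_def)
    then show "w \<in> \<Inter>((\<lambda>h. {w. a h \<bullet> w \<le> 0}) ` G)"
      using q by (fastforce simp: G_def inner_simps mult_le_0_iff)
  next
    fix w assume w: "w \<in> \<Inter>((\<lambda>h. {w. a h \<bullet> w \<le> 0}) ` G)"
    have "\<forall>\<^sub>F \<epsilon> in at_right (0::real). a h \<bullet> (y + \<epsilon> *\<^sub>R w) \<le> b h" if h: "h \<in> F" for h
    proof (cases "h \<in> G")
      case True
      then have "a h \<bullet> w \<le> 0" "a h \<bullet> y = b h" using w by (auto simp: G_def)
      have "\<forall>\<^sub>F \<epsilon> in at_right (0::real). 0 < \<epsilon>" by (rule eventually_at_right_less)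
      then show ?thesis
        by eventually_elim (use \<open>a h \<bullet> w \<le> 0\<close> \<open>a h \<bullet> y = b h\<close> in \<open>simp add: inner_simps mult_le_0_iff\<close>)
    next
      case False
      then have lt: "a h \<bullet> y < b h" using assms(2) q h by (force simp: G_def)
      have "((\<lambda>\<epsilon>::real. a h \<bullet> (y + \<epsilon> *\<^sub>R w)) \<longlongrightarrow> a h \<bullet> (y + 0 *\<^sub>R w)) (at_right 0)"
        by (intro tendsto_intros)
      then have "\<forall>\<^sub>F \<epsilon> in at_right (0::real). a h \<bullet> (y + \<epsilon> *\<^sub>R w) < b h"
        by (rule order_tendstoD) (use lt in simp)
      then show ?thesis by (rule eventually_mono) simp
    qed
    then have "\<forall>\<^sub>F \<epsilon> in at_right (0::real). \<forall>h\<in>F. a h \<bullet> (y + \<epsilon> *\<^sub>R w) \<le> b h"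
      using F by (simp add: eventually_ball_finite)
    then have "\<forall>\<^sub>F \<epsilon> in at_right (0::real). y + \<epsilon> *\<^sub>R w \<in> q"
      by (simp add: q)
    then show "w \<in> feasible_dirs q y"
      using eventually_step_iff_feasible assms polyhedron_imp_convex by blast
  qed
  then show ?thesis
    using F by (auto simp: G_def intro!: polyhedron_Inter polyhedron_halfspace_le)
qed

lemma polyhedron_affine_preimage:
  fixes f :: "'a::euclidean_space \<Rightarrow> 'b::euclidean_space"
  assumes "linear f" "polyhedron Q"
  shows "polyhedron {x. f x - c \<in> Q}"
proof -
  obtain F :: "'b set set" and a b where F: "finite F" and Q: "\<And>z. z \<in> Q \<longleftrightarrow> (\<forall>h\<in>F. a h \<bullet> z \<le> b h)"
    using polyhedron_inequalities[OF assms(2)] by blast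
  have "{x. f x - c \<in> Q} = \<Inter>((\<lambda>h. {x. adjoint f (a h) \<bullet> x \<le> b h + a h \<bullet> c}) ` F)"
    by (auto simp: Q inner_diff_right adjoint_clauses(2)[OF assms(1)] diff_le_eq)
  then show ?thesis
    using F by (auto intro!: polyhedron_Inter polyhedron_halfspace_le)
qed

subsection \<open>Brion's theorem\<close>

text \<open>Every point of \<open>S\<close> has positive weight. Hence a linear functional that
  takes at this point its minimum over a set containing \<open>S\<close> is constant on
  \<open>S\<close>.\<close>

definition barycentre :: "'a::real_vector set \<Rightarrow> 'a" where
  "barycentre S = (1 / real (card S)) *\<^sub>R (\<Sum>s\<in>S. s)"

definition point_cone :: "'a::real_vector set \<Rightarrow> 'a \<Rightarrow> 'a set" where
  "point_cone q y = {x. x - y \<in> feasible_dirs q y}"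

lemma barycentre_in_convex_hull:
  assumes "finite S" "S \<noteq> {}"
  shows "barycentre S \<in> convex hull S"
proof -
  have "(\<Sum>s\<in>S. (1 / real (card S)) *\<^sub>R s) \<in> convex hull S"
    using assms by (intro convex_sum) (auto intro: hull_inc)
  then show ?thesis by (simp add: barycentre_def scaleR_sum_right)
qed

lemma sum_diff_barycentre:
  assumes "finite S" "S \<noteq> {}"
  shows "(\<Sum>s\<in>S. s - barycentre S) = 0"
proof -
  have "real (card S) *\<^sub>R barycentre S = (\<Sum>s\<in>S. s)"
    using assms by (simp add: barycentre_def)
  then show ?thesis by (simp add: sum_subtractf scaleR_conv_of_real sum_constant_scaleR)
qed

lemma polyhedron_point_cone:
  fixes q :: "'a::euclidean_space set"
  assumes "polyhedron q" "y \<in> q"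
  shows "polyhedron (point_cone q y)"
  unfolding point_cone_def
  using polyhedron_affine_preimage[OF linear_id polyhedron_feasible_dirs[OF assms]] by simp

text \<open>Some \<open>s\<close> in \<open>S\<close> differs from the barycentre. The barycentre of
  \<open>S - {s}\<close> lies on the opposite side of it, so both directions of the line through
  \<open>s\<close> and the barycentre are feasible.\<close>

lemma contains_line_point_cone:
  assumes "finite S" "card S \<ge> 2" "S \<subseteq> q" "convex q"
  shows "contains_line (point_cone q (barycentre S))"
proof -
  let ?y = "barycentre S"
  have "S \<noteq> {}" using assms by auto
  have y: "?y \<in> q"
    using barycentre_in_convex_hull[OF assms(1) \<open>S \<noteq> {}\<close>] hull_minimal[of S q convex] assms by auto
  obtain s where s: "s \<in> S" "s \<noteq> ?y"
  proof (rule ccontr)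
    assume "\<not> thesis"
    then have "S \<subseteq> {?y}" using that by blast
    then show False using assms(2) card_mono[of "{?y}" S] by simp
  qed
  let ?n = "real (card S) - 1"
  have n: "?n > 0" using assms(2) by linarith
  have pos: "s - ?y \<in> feasible_dirs q ?y" using s assms by (auto intro: diff_in_feasible_dirs)
  have "S \<noteq> {s}" using assms(2) by auto
  then have ne: "S - {s} \<noteq> {}" using s by blast
  have nn: "real (card (S - {s})) = ?n" using s assms by (simp add: of_nat_diff)
  have bq: "barycentre (S - {s}) \<in> q"
    using barycentre_in_convex_hull[of "S - {s}"] ne hull_minimal[of "S - {s}" q convex] assms by auto
  have "?n *\<^sub>R (barycentre (S - {s}) - ?y) = (\<Sum>s\<in>S - {s}. s) - ?n *\<^sub>R ?y"
    using n by (simp add: barycentre_def nn scaleR_right_diff_distrib)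
  also have "\<dots> = (\<Sum>t\<in>S - {s}. t - ?y)"
    by (simp add: sum_subtractf sum_constant_scaleR nn)
  also have "\<dots> = - (s - ?y)"
    using sum_diff_barycentre[OF assms(1) \<open>S \<noteq> {}\<close>] sum.remove[OF assms(1) s(1), of "\<lambda>t. t - ?y"]
    by (metis add_eq_0_iff)
  finally have neg: "- (s - ?y) \<in> feasible_dirs q ?y"
    using feasible_dirs_scale[OF diff_in_feasible_dirs[OF bq] n] by metis
  have "?y + t *\<^sub>R (s - ?y) \<in> point_cone q ?y" for t
  proof -
    consider "t > 0" | "t = 0" | "t < 0" by linarith
    then have "t *\<^sub>R (s - ?y) \<in> feasible_dirs q ?y"
    proof cases
      case 3
      then have "(- t) *\<^sub>R (- (s - ?y)) \<in> feasible_dirs q ?y" by (intro feasible_dirs_scale[OF neg]) simp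
      then show ?thesis by (simp only: scaleR_minus_left scaleR_minus_right minus_minus)
    qed (use feasible_dirs_scale[OF pos] zero_in_feasible_dirs[OF y] in auto)
    then show ?thesis by (simp add: point_cone_def)
  qed
  then show ?thesis using s unfolding contains_line_def by (metis right_minus_eq)
qed

text \<open>Separating \<open>x\<close> from the cone gives a functional \<open>a\<close> that is
  nonnegative on the feasible directions. Its values on the vectors from the barycentre to
  \<open>S\<close> are nonnegative with sum zero, so \<open>a\<close> is minimal over
  \<open>V\<close> at each point of \<open>S\<close>. Rescaling replaces strict negativity by the
  bound -1, which makes the set of witnesses closed.\<close>

lemma notin_point_cone_iff:
  fixes V :: "'a::euclidean_space set"
  assumes V: "finite V" and S: "S \<subseteq> V" "S \<noteq> {}"
  shows "x \<notin> point_cone (convex hull V) (barycentre S) \<longleftrightarrow>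
    (\<exists>a. \<forall>s\<in>S. (\<forall>v\<in>V. a \<bullet> s \<le> a \<bullet> v) \<and> a \<bullet> (x - s) \<le> - 1)" (is "_ \<longleftrightarrow> ?R")
proof -
  let ?q = "convex hull V" and ?y = "barycentre S"
  let ?K = "feasible_dirs ?q ?y"
  have finS: "finite S" using S V finite_subset by blast
  have y: "?y \<in> ?q" using barycentre_in_convex_hull[OF finS S(2)] hull_mono[OF S(1)] by blast
  have poly: "polyhedron ?K"
    using polyhedron_feasible_dirs[OF polyhedron_convex_hull[OF V] y] .
  have sumy: "(\<Sum>s\<in>S. a \<bullet> (s - ?y)) = 0" for a
    using sum_diff_barycentre[OF finS S(2)] by (metis inner_sum_right inner_zero_right)
  show ?thesis
  proof
    assume "x \<notin> point_cone ?q ?y"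
    then have "x - ?y \<notin> ?K" by (simp add: point_cone_def)
    from separating_hyperplane_closed_point[OF polyhedron_imp_convex[OF poly]
        polyhedron_imp_closed[OF poly] this]
    obtain a b where ab: "a \<bullet> (x - ?y) < b" "\<And>k. k \<in> ?K \<Longrightarrow> b < a \<bullet> k" by auto
    have b: "b < 0" using ab(2)[OF zero_in_feasible_dirs[OF y]] by simp
    \<comment> \<open>If \<open>a\<close> were negative at \<open>k\<close>, a positive multiple of
      \<open>k\<close> would give \<open>a\<close> the value \<open>b\<close>, against strict
      separation.\<close>
    have nonneg: "a \<bullet> k \<ge> 0" if k: "k \<in> ?K" for k
    proof (rule ccontr)
      assume "\<not> a \<bullet> k \<ge> 0"
      then have "b / (a \<bullet> k) > 0" using b by (simp add: divide_neg_neg)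
      from ab(2)[OF feasible_dirs_scale[OF k this]] show False
        using \<open>\<not> a \<bullet> k \<ge> 0\<close> by simp
    qed
    have V0: "a \<bullet> (v - ?y) \<ge> 0" if "v \<in> V" for v
      using nonneg[OF diff_in_feasible_dirs] that by (simp add: hull_inc)
    have "\<forall>s\<in>S. a \<bullet> (s - ?y) = 0"
      using sumy[of a] finS S V0 sum_nonneg_eq_0_iff[of S "\<lambda>s. a \<bullet> (s - ?y)"] by blast
    then have S0: "a \<bullet> s = a \<bullet> ?y" if "s \<in> S" for s using that by (simp add: inner_simps)
    define r where "r = - (a \<bullet> (x - ?y))"
    have r: "r > 0" using ab b by (simp add: r_def)
    have "(\<forall>v\<in>V. (a /\<^sub>R r) \<bullet> s \<le> (a /\<^sub>R r) \<bullet> v) \<and> (a /\<^sub>R r) \<bullet> (x - s) \<le> - 1" if s: "s \<in> S" for s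
    proof
      show "\<forall>v\<in>V. (a /\<^sub>R r) \<bullet> s \<le> (a /\<^sub>R r) \<bullet> v"
        using V0 S0[OF s] r by (auto simp: inner_simps intro!: divide_right_mono mult_left_mono)
      have "a \<bullet> (x - s) = - r" using S0[OF s] by (simp add: r_def inner_simps)
      then show "(a /\<^sub>R r) \<bullet> (x - s) \<le> - 1" using r by simp
    qed
    then show ?R by blast
  next
    assume ?R
    then obtain a where a: "\<And>s v. s \<in> S \<Longrightarrow> v \<in> V \<Longrightarrow> a \<bullet> s \<le> a \<bullet> v"
      "\<And>s. s \<in> S \<Longrightarrow> a \<bullet> (x - s) \<le> - 1" by blast
    obtain s0 where s0: "s0 \<in> S" using S by blast
    have "a \<bullet> s = a \<bullet> s0" if "s \<in> S" for s
      using a(1)[OF that] a(1)[OF s0] that s0 S by (simp add: antisym subset_iff)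
    then have "(\<Sum>s\<in>S. a \<bullet> (s0 - ?y)) = 0" using sumy[of a] by (simp add: inner_simps)
    then have ay: "a \<bullet> ?y = a \<bullet> s0" using finS S by (simp add: inner_simps)
    have "?q \<subseteq> {z. a \<bullet> z \<ge> a \<bullet> s0}"
      using a(1)[OF s0] by (intro hull_minimal) (auto simp: convex_halfspace_ge)
    moreover have "a \<bullet> (?y + \<epsilon> *\<^sub>R (x - ?y)) < a \<bullet> s0" if "\<epsilon> > 0" for \<epsilon>
    proof -
      have "a \<bullet> (x - ?y) < 0" using a(2)[OF s0] ay by (simp add: inner_simps)
      then have "\<epsilon> * (a \<bullet> (x - ?y)) < 0" using that by (simp add: mult_pos_neg)
      then show ?thesis using ay by (simp add: inner_add_right)
    qed
    ultimately show "x \<notin> point_cone ?q ?y"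
      unfolding point_cone_def feasible_dirs_def by fastforce
  qed
qed

lemma notin_convex_hull_iff:
  fixes V :: "'a::euclidean_space set"
  assumes V: "finite V"
  shows "x \<notin> convex hull V \<longleftrightarrow> (\<exists>a. \<forall>v\<in>V. a \<bullet> (x - v) \<le> - 1)"
proof
  assume "x \<notin> convex hull V"
  then obtain a b where ab: "a \<bullet> x < b" "\<And>v. v \<in> convex hull V \<Longrightarrow> b < a \<bullet> v"
    using separating_hyperplane_closed_point[of "convex hull V" x] finite_imp_compact_convex_hull[OF V]
      compact_imp_closed convex_convex_hull by blast
  \<comment> \<open>The gap of the separation; dividing \<open>a\<close> by it gives the bound
    -1.\<close>
  define r where "r = b - a \<bullet> x"
  have r: "r > 0" using ab by (simp add: r_def)
  have "(a /\<^sub>R r) \<bullet> (x - v) \<le> - 1" if "v \<in> V" for v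
  proof -
    have "a \<bullet> (x - v) \<le> - r" using ab(2)[of v] that by (simp add: r_def inner_simps hull_inc less_imp_le)
    then show ?thesis using r by (simp add: field_simps)
  qed
  then show "\<exists>a. \<forall>v\<in>V. a \<bullet> (x - v) \<le> - 1" by blast
next
  assume "\<exists>a. \<forall>v\<in>V. a \<bullet> (x - v) \<le> - 1"
  then obtain a where a: "\<And>v. v \<in> V \<Longrightarrow> a \<bullet> (x - v) \<le> - 1" by blast
  have "convex hull V \<subseteq> {z. a \<bullet> z \<ge> a \<bullet> x + 1}"
    using a by (intro hull_minimal) (force simp: convex_halfspace_ge inner_simps)+
  then show "x \<notin> convex hull V" by auto
qed

text \<open>At a point \<open>x\<close>, the normal vectors witnessing that \<open>x\<close> lies outside the cone at the barycentre
  of \<open>S\<close> form the intersection over \<open>S\<close> of closed convex sets whose union is the convex set of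
  normal vectors witnessing that \<open>x\<close> lies outside the convex hull.\<close>

lemma gram_relation:
  fixes V :: "'a::euclidean_space set"
  assumes V: "finite V" "V \<noteq> {}"
  shows "indicator (convex hull V) x =
    (\<Sum>S\<in>Pow V - {{}}. (- 1) ^ (card S + 1) * indicator (point_cone (convex hull V) (barycentre S)) x :: real)"
proof -
  let ?q = "convex hull V"
  define M where "M s = {a. (\<forall>v\<in>V. a \<bullet> s \<le> a \<bullet> v) \<and> a \<bullet> (x - s) \<le> - 1}" for s
  define N where "N S = \<Union>(M ` V) \<inter> \<Inter>(M ` S)" for S
  have U: "\<Union>(M ` V) = {a. \<forall>v\<in>V. a \<bullet> (x - v) \<le> - 1}"
  proof (intro equalityI subsetI)
    fix a assume "a \<in> {a. \<forall>v\<in>V. a \<bullet> (x - v) \<le> - 1}"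
    then have a: "\<And>v. v \<in> V \<Longrightarrow> a \<bullet> (x - v) \<le> - 1" by blast
    \<comment> \<open>The functional attains its minimum over the finite set \<open>V\<close> at
      some \<open>s\<close>, which puts it into \<open>M s\<close>.\<close>
    obtain s where "s \<in> V" "\<And>v. v \<in> V \<Longrightarrow> a \<bullet> s \<le> a \<bullet> v"
      using ex_min_if_finite[of "(\<bullet>) a ` V"] V by (auto simp: not_less)
    then show "a \<in> \<Union>(M ` V)" using a by (auto simp: M_def)
  qed (fastforce simp: M_def inner_simps)
  have halfspaces: "closed {a. \<forall>v\<in>V. a \<bullet> d v \<le> c}" "convex {a. \<forall>v\<in>V. a \<bullet> d v \<le> c}"
    for d :: "'a \<Rightarrow> 'a" and c
  proof -
    have "{a. \<forall>v\<in>V. a \<bullet> d v \<le> c} = (\<Inter>v\<in>V. {a. d v \<bullet> a \<le> c})" by (auto simp: inner_commute)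
    then show "closed {a. \<forall>v\<in>V. a \<bullet> d v \<le> c}" "convex {a. \<forall>v\<in>V. a \<bullet> d v \<le> c}"
      by (auto intro!: closed_INT convex_INT closed_halfspace_le convex_halfspace_le)
  qed
  have M: "closed (M s) \<and> convex (M s)" for s
  proof -
    have "M s = {a. \<forall>v\<in>V. a \<bullet> (s - v) \<le> 0} \<inter> {a. \<forall>v\<in>V. a \<bullet> (x - s) \<le> - 1}"
      using V by (auto simp: M_def inner_simps)
    then show ?thesis
      using closed_Int[OF halfspaces(1)[of "\<lambda>v. s - v" 0] halfspaces(1)[of "\<lambda>v. x - s" "-1"]]
        convex_Int[OF halfspaces(2)[of "\<lambda>v. s - v" 0] halfspaces(2)[of "\<lambda>v. x - s" "-1"]]
      by simp
  qed
  \<comment> \<open>The empty set indexes the whole union, and so produces the term of the convex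
    hull itself.\<close>
  have N_empty: "N {} \<noteq> {} \<longleftrightarrow> x \<notin> ?q"
    using notin_convex_hull_iff[OF V(1), of x] by (auto simp: N_def U)
  have N: "N S \<noteq> {} \<longleftrightarrow> x \<notin> point_cone ?q (barycentre S)" if "S \<in> Pow V - {{}}" for S
  proof -
    have "N S = {a. \<forall>s\<in>S. (\<forall>v\<in>V. a \<bullet> s \<le> a \<bullet> v) \<and> a \<bullet> (x - s) \<le> - 1}"
      using that by (auto simp: N_def M_def)
    then show ?thesis using notin_point_cone_iff[of V S x] V that by simp
  qed
  have "(\<Sum>S\<in>{S\<in>Pow V. N S \<noteq> {}}. (- 1) ^ card S) = (0::real)"
    unfolding N_def using V(1) M halfspaces by (intro nerve_convex_union) (auto simp: U)
  then have "0 = (\<Sum>S\<in>Pow V. if N S \<noteq> {} then (- 1) ^ card S else (0::real))"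
    by (subst (asm) sum.inter_filter) (simp_all add: V(1))
  \<comment> \<open>Nonempty \<open>N S\<close> records that \<open>x\<close> is outside a set.
    Since all signs together sum to zero, passing to the complementary condition turns the relation
    into one between indicators.\<close>
  also have "\<dots> = (\<Sum>S\<in>Pow V. (- 1) ^ card S) - (\<Sum>S\<in>Pow V. if N S = {} then (- 1) ^ card S else 0)"
    by (subst sum_subtractf[symmetric]) (rule sum.cong, auto)
  also have "(\<Sum>S\<in>Pow V. (- 1) ^ card S) = (0::real)"
    using V by (simp add: sum_Pow_minus_one_power)
  also have "(\<Sum>S\<in>Pow V. if N S = {} then (- 1) ^ card S else (0::real)) =
      indicator ?q x + (\<Sum>S\<in>Pow V - {{}}. if N S = {} then (- 1) ^ card S else 0)"
    using V(1) N_empty by (subst sum.remove[of _ "{}"]) (auto simp: indicator_def)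
  also have "(\<Sum>S\<in>Pow V - {{}}. if N S = {} then (- 1) ^ card S else (0::real)) =
      - (\<Sum>S\<in>Pow V - {{}}. (- 1) ^ (card S + 1) * indicator (point_cone ?q (barycentre S)) x)"
    unfolding sum_negf[symmetric]
  proof (rule sum.cong)
    fix S assume "S \<in> Pow V - {{}}"
    from N[OF this] show "(if N S = {} then (- 1) ^ card S else (0::real)) =
      - ((- 1) ^ (card S + 1) * indicator (point_cone ?q (barycentre S)) x)"
      by (auto simp: indicator_def)
  qed simp
  finally show ?thesis by simp
qed

text \<open>This is \<open>gram_relation\<close> for the vertex set, with the singletons split off:
  the barycentre of a singleton is the vertex itself. The remaining cones contain lines.\<close>

lemma brion_relation:
  fixes q :: "'a::euclidean_space set"
  assumes "polytope q" "q \<noteq> {}"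
  defines "V \<equiv> {v. v extreme_point_of q}"
  shows "indicator q x = (\<Sum>v\<in>V. indicator (point_cone q v) x) +
    (\<Sum>S\<in>{S\<in>Pow V. card S \<ge> 2}. (- 1) ^ (card S + 1) * indicator (point_cone q (barycentre S)) x :: real)"
proof -
  have V: "finite V"
    unfolding V_def using assms(1) by (intro finite_polyhedron_extreme_points polytope_imp_polyhedron)
  have q: "q = convex hull V"
    unfolding V_def using assms(1) by (intro Krein_Milman_Minkowski polytope_imp_compact polytope_imp_convex)
  have "V \<noteq> {}" using q assms(2) by auto
  have card1: "S \<in> (\<lambda>v. {v}) ` V \<or> card S \<ge> 2" if "S \<subseteq> V" "S \<noteq> {}" for S
  proof -
    have "finite S" using that V finite_subset by blast
    then have "card S \<noteq> 0" using that by simp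
    then have "card S = 1 \<or> card S \<ge> 2" by linarith
    then show ?thesis using that card_1_singletonE[of S] by blast
  qed
  let ?t = "\<lambda>S. (- 1) ^ (card S + 1) * indicator (point_cone q (barycentre S)) x :: real"
  have "indicator q x = (\<Sum>S\<in>Pow V - {{}}. ?t S)"
    using gram_relation[OF V \<open>V \<noteq> {}\<close>, of x] q by simp
  also have "Pow V - {{}} = (\<lambda>v. {v}) ` V \<union> {S\<in>Pow V. card S \<ge> 2}"
    using card1 by auto
  also have "sum ?t \<dots> = sum ?t ((\<lambda>v. {v}) ` V) + sum ?t {S\<in>Pow V. card S \<ge> 2}"
    using V by (intro sum.union_disjoint) auto
  also have "sum ?t ((\<lambda>v. {v}) ` V) = (\<Sum>v\<in>V. indicator (point_cone q v) x)"
    by (subst sum.reindex) (auto simp: barycentre_def)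
  finally show ?thesis .
qed

subsection \<open>The span of indicators of polyhedra containing a line\<close>

text \<open>The inductive form makes closure under sums and multiples a rule induction;
  \<open>line_span_combination\<close> returns to the indexed combinations in
  \<open>vequiv\<close>.\<close>

inductive_set line_span :: "('a::euclidean_space \<Rightarrow> real) set" where
  zero: "(\<lambda>x. 0) \<in> line_span"
| step: "F \<in> line_span \<Longrightarrow> polyhedron Q \<Longrightarrow> contains_line Q \<Longrightarrow>
    (\<lambda>x. F x + c * indicator Q x) \<in> line_span"

lemma line_span_indicator:
  "polyhedron Q \<Longrightarrow> contains_line Q \<Longrightarrow> (\<lambda>x. c * indicator Q x) \<in> line_span"
  using line_span.step[OF line_span.zero, of Q c] by simp

lemma line_span_add:
  assumes "F \<in> line_span" "G \<in> line_span"
  shows "(\<lambda>x. F x + G x) \<in> line_span"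
  using assms(2)
proof induction
  case (step G Q c)
  then have "(\<lambda>x. (F x + G x) + c * indicator Q x) \<in> line_span" by (intro line_span.step)
  then show ?case by (simp add: add.assoc)
qed (use assms in simp)

lemma line_span_scale:
  assumes "F \<in> line_span"
  shows "(\<lambda>x. k * F x) \<in> line_span"
  using assms
proof induction
  case (step F Q c)
  then have "(\<lambda>x. k * F x + (k * c) * indicator Q x) \<in> line_span" by (intro line_span.step)
  then show ?case by (simp add: algebra_simps)
qed (simp add: line_span.zero)

lemma line_span_sum:
  assumes "\<And>i. i \<in> I \<Longrightarrow> F i \<in> line_span"
  shows "(\<lambda>x. \<Sum>i\<in>I. F i x) \<in> line_span"
  using assms
  by (induction I rule: infinite_finite_induct) (auto intro: line_span.zero line_span_add)

lemma line_span_combination: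
  assumes "F \<in> line_span"
  shows "\<exists>(I::nat set) c Q. finite I \<and> (\<forall>i\<in>I. polyhedron (Q i) \<and> contains_line (Q i)) \<and>
      (\<forall>x. F x = (\<Sum>i\<in>I. c i * indicator (Q i) x))"
  using assms
proof induction
  case zero
  show ?case by (intro exI[of _ "{}"]) simp
next
  case (step F Q c)
  then obtain I :: "nat set" and d R where I: "finite I" "\<forall>i\<in>I. polyhedron (R i) \<and> contains_line (R i)"
    "\<forall>x. F x = (\<Sum>i\<in>I. d i * indicator (R i) x)" by blast
  obtain n where n: "n \<notin> I" using I(1) ex_new_if_finite infinite_UNIV_nat by blast
  have "(\<Sum>i\<in>I. (d(n := c)) i * indicator ((R(n := Q)) i) x) = (\<Sum>i\<in>I. d i * indicator (R i) x)" for x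
    using n by (intro sum.cong) auto
  then show ?case
    using I n step.hyps
    by (intro exI[of _ "insert n I"] exI[of _ "d(n := c)"] exI[of _ "R(n := Q)"])
       (simp del: sum_mult_indicator fun_upd_apply, auto)
qed

lemma vequivI:
  assumes "(\<lambda>x. F x - G x) \<in> line_span"
  shows "vequiv F G"
  using line_span_combination[OF assms] by (simp add: vequiv_def)

subsection \<open>Orthogonal projections\<close>

lemma subspace_orth_compl: "subspace (orth_compl W)"
  by (auto simp: orth_compl_def subspace_def inner_simps)

lemma oproj_unique:
  assumes "subspace W" "y \<in> W" "x - y \<in> orth_compl W"
  shows "oproj W x = y"
  unfolding oproj_def
proof (rule the_equality)
  show "y \<in> W \<and> (\<forall>w\<in>W. (x - y) \<bullet> w = 0)" using assms by (auto simp: orth_compl_def)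
  fix z assume z: "z \<in> W \<and> (\<forall>w\<in>W. (x - z) \<bullet> w = 0)"
  then have "z - y \<in> W" using assms subspace_diff by blast
  then have "(x - y) \<bullet> (z - y) = 0" "(x - z) \<bullet> (z - y) = 0"
    using z assms by (auto simp: orth_compl_def)
  then have "(z - y) \<bullet> (z - y) = 0" by (simp add: inner_simps)
  then show "z = y" by simp
qed

lemma oproj:
  fixes W :: "'a::euclidean_space set"
  assumes "subspace W"
  shows oproj_in: "oproj W x \<in> W" and diff_oproj_in: "x - oproj W x \<in> orth_compl W"
proof -
  obtain y z where "y \<in> span W" "\<And>w. w \<in> span W \<Longrightarrow> orthogonal z w" "x = y + z"
    using orthogonal_subspace_decomp_exists[of W x] by blast
  then have y: "y \<in> W" "x - y \<in> orth_compl W"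
    using assms by (auto simp: orth_compl_def orthogonal_def span_superset[THEN subsetD]
        span_eq_iff[THEN iffD2])
  from oproj_unique[OF assms y] y show "oproj W x \<in> W" "x - oproj W x \<in> orth_compl W" by auto
qed

lemma oproj_id: "subspace W \<Longrightarrow> y \<in> W \<Longrightarrow> oproj W y = y"
  by (rule oproj_unique) (auto simp: orth_compl_def)

lemma oproj_add_orth:
  assumes "subspace W" "a \<in> W" "b \<in> orth_compl W"
  shows "oproj W (a + b) = a"
  using assms by (intro oproj_unique) auto

lemma linear_oproj:
  fixes W :: "'a::euclidean_space set"
  assumes W: "subspace W"
  shows "linear (oproj W)"
proof (rule linearI)
  fix x y :: 'a and r :: real
  have "(x - oproj W x) + (y - oproj W y) \<in> orth_compl W"
    using subspace_add[OF subspace_orth_compl diff_oproj_in[OF W] diff_oproj_in[OF W]] .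
  then show "oproj W (x + y) = oproj W x + oproj W y"
    by (intro oproj_unique W subspace_add oproj_in) (simp add: algebra_simps)
  have "r *\<^sub>R (x - oproj W x) \<in> orth_compl W"
    using subspace_scale[OF subspace_orth_compl diff_oproj_in[OF W]] .
  then show "oproj W (r *\<^sub>R x) = r *\<^sub>R oproj W x"
    by (intro oproj_unique W subspace_scale oproj_in) (simp add: algebra_simps)
qed

lemma oproj_orth_compl:
  fixes W :: "'a::euclidean_space set"
  assumes W: "subspace W"
  shows "oproj (orth_compl W) x = x - oproj W x"
  using diff_oproj_in[OF W, of x] oproj_in[OF W, of x]
  by (intro oproj_unique subspace_orth_compl) (auto simp: orth_compl_def inner_commute)

text \<open>Orthogonality forces the decomposition of \<open>y\<close>, so membership in a Minkowski
  sum, and with it polyhedrality, can be tested on the two components.\<close>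

lemma orth_sum_eq_preimage:
  fixes W :: "'a::euclidean_space set"
  assumes W: "subspace W" and "A \<subseteq> W" "B \<subseteq> orth_compl W"
  shows "{a + b | a b. a \<in> A \<and> b \<in> B} = {y. oproj W y \<in> A \<and> y - oproj W y \<in> B}"
proof (intro equalityI subsetI)
  fix y assume "y \<in> {a + b | a b. a \<in> A \<and> b \<in> B}"
  then show "y \<in> {y. oproj W y \<in> A \<and> y - oproj W y \<in> B}"
    using assms oproj_add_orth[OF W] by force
next
  fix y assume "y \<in> {y. oproj W y \<in> A \<and> y - oproj W y \<in> B}"
  moreover have "y = oproj W y + (y - oproj W y)" by simp
  ultimately show "y \<in> {a + b | a b. a \<in> A \<and> b \<in> B}" by blast
qed

lemma polyhedron_orth_product:
  fixes W :: "'a::euclidean_space set"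
  assumes W: "subspace W" and "polyhedron A" "polyhedron B"
  shows "polyhedron {y. oproj W y \<in> A \<and> y - oproj W y - c \<in> B}"
proof -
  have "linear (\<lambda>y. y - oproj W y)"
    using linear_compose_sub[OF linear_ident linear_oproj[OF W]] by simp
  then have "polyhedron ({y. oproj W y - 0 \<in> A} \<inter> {y. y - oproj W y - c \<in> B})"
    using polyhedron_affine_preimage[OF _ assms(3), of "\<lambda>y. y - oproj W y" c]
      polyhedron_affine_preimage[OF linear_oproj[OF W] assms(2), of 0] by blast
  then show ?thesis by (simp add: Int_def)
qed

text \<open>Brion's relation for \<open>q\<close>, read in the component along \<open>W\<close>, is
  multiplied by a fixed indicator in the orthogonal component. The error terms remain negligible: a
  line in a factor inside \<open>W\<close>, shifted by \<open>d + c\<close> for any point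
  \<open>d\<close> of \<open>C\<close>, is a line in the product.\<close>

lemma brion_product:
  fixes q :: "'a::euclidean_space set"
  assumes W: "subspace W" and q: "polytope q" "q \<noteq> {}" "q \<subseteq> W"
    and C: "polyhedron C" "C \<noteq> {}" "C \<subseteq> orth_compl W" and c: "c \<in> orth_compl W"
  shows "(\<lambda>x. indicator q (oproj W x) * indicator C (x - oproj W x - c) -
    (\<Sum>v\<in>{v. v extreme_point_of q}.
       indicator (point_cone q v) (oproj W x) * indicator C (x - oproj W x - c))) \<in> line_span"
proof -
  define V where "V = {v. v extreme_point_of q}"
  have V: "finite V"
    unfolding V_def using q by (intro finite_polyhedron_extreme_points polytope_imp_polyhedron)
  have Vq: "V \<subseteq> q" by (auto simp: V_def extreme_point_of_def)
  let ?Q = "\<lambda>S. {x. oproj W x \<in> point_cone q (barycentre S) \<and> x - oproj W x - c \<in> C}"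
  let ?L = "{S\<in>Pow V. card S \<ge> 2}"
  have "(\<lambda>x. (- 1) ^ (card S + 1) * indicator (?Q S) x) \<in> line_span" if S: "S \<in> ?L" for S
  proof (rule line_span_indicator)
    have finS: "finite S" and ne: "S \<noteq> {}" using S V finite_subset by auto
    have y: "barycentre S \<in> q"
      using barycentre_in_convex_hull[OF finS ne] hull_minimal[of S q convex] S Vq
        polytope_imp_convex[OF q(1)] by auto
    show "polyhedron (?Q S)"
      using polyhedron_orth_product[OF W polyhedron_point_cone[OF polytope_imp_polyhedron[OF q(1)] y] C(1)] .
    have sub: "point_cone q (barycentre S) \<subseteq> W"
    proof
      fix x assume "x \<in> point_cone q (barycentre S)"
      then have "x - barycentre S \<in> W"
        using feasible_dirs_subset_subspace[OF W, of q "barycentre S"] subspace_diff[OF W] q(3) y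
        by (auto simp: point_cone_def)
      then show "x \<in> W" using subspace_add[OF W, of "x - barycentre S" "barycentre S"] q(3) y by auto
    qed
    obtain x u where u: "u \<noteq> 0" "\<And>t::real. x + t *\<^sub>R u \<in> point_cone q (barycentre S)"
      using contains_line_point_cone[OF finS, of q] S Vq polytope_imp_convex[OF q(1)]
      by (auto simp: contains_line_def)
    obtain d where d: "d \<in> C" using C by blast
    have dc: "d + c \<in> orth_compl W" using subspace_add[OF subspace_orth_compl] d C c by blast
    have "x + (d + c) + t *\<^sub>R u \<in> ?Q S" for t
    proof -
      have "oproj W ((x + t *\<^sub>R u) + (d + c)) = x + t *\<^sub>R u"
        using oproj_add_orth[OF W _ dc] u(2) sub by blast
      then have "oproj W (x + (d + c) + t *\<^sub>R u) = x + t *\<^sub>R u" by (simp add: algebra_simps)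
      then show ?thesis using u(2) d by simp
    qed
    then show "contains_line (?Q S)" using u(1) unfolding contains_line_def by blast
  qed
  then have "(\<lambda>x. \<Sum>S\<in>?L. (- 1) ^ (card S + 1) * indicator (?Q S) x) \<in> line_span"
    by (rule line_span_sum)
  moreover have "indicator q (oproj W x) * indicator C (x - oproj W x - c) -
      (\<Sum>v\<in>V. indicator (point_cone q v) (oproj W x) * indicator C (x - oproj W x - c)) =
      (\<Sum>S\<in>?L. (- 1) ^ (card S + 1) * indicator (?Q S) x :: real)" for x
  proof -
    have "(\<Sum>S\<in>?L. (- 1) ^ (card S + 1) * indicator (?Q S) x) =
      (\<Sum>S\<in>?L. (- 1) ^ (card S + 1) * indicator (point_cone q (barycentre S)) (oproj W x)) *
        (indicator C (x - oproj W x - c) :: real)"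
      unfolding sum_distrib_right by (rule sum.cong) (auto simp: indicator_def)
    then show ?thesis
      using brion_relation[OF q(1,2), of "oproj W x"]
      by (simp add: V_def algebra_simps sum_distrib_left)
  qed
  ultimately show ?thesis by (simp add: V_def)
qed

subsection \<open>Linear spans of faces and transverse cones\<close>

lemma lin_eq_translate:
  assumes "a \<in> affine hull f"
  shows "lin f = (\<lambda>x. x - a) ` (affine hull f)"
proof (intro equalityI subsetI)
  fix u assume "u \<in> lin f"
  then obtain x y where "x \<in> affine hull f" "y \<in> affine hull f" "u = x - y" by (auto simp: lin_def)
  then have "a + u \<in> affine hull f"
    using mem_affine_3_minus[OF affine_affine_hull assms, of x y 1] by simp
  then show "u \<in> (\<lambda>x. x - a) ` (affine hull f)" by (auto intro!: image_eqI[of _ _ "a + u"])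
qed (use assms in \<open>auto simp: lin_def\<close>)

lemma subspace_lin:
  fixes f :: "'a::euclidean_space set"
  assumes "f \<noteq> {}"
  shows "subspace (lin f)"
proof -
  obtain a where "a \<in> affine hull f" using assms hull_subset by fastforce
  then show ?thesis
    using lin_eq_translate affine_diffs_subspace_subtract[OF affine_affine_hull] by metis
qed

lemma diff_in_lin: "x \<in> f \<Longrightarrow> y \<in> f \<Longrightarrow> x - y \<in> lin f"
  unfolding lin_def using hull_inc[of x f affine] hull_inc[of y f affine] by auto

lemma lin_mono: "f \<subseteq> g \<Longrightarrow> lin f \<subseteq> lin g"
  using hull_mono[of f g affine] by (fastforce simp: lin_def)

lemma orth_compl_antimono: "W \<subseteq> W' \<Longrightarrow> orth_compl W' \<subseteq> orth_compl W"
  by (auto simp: orth_compl_def)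

lemma oproj_eq_diff:
  fixes f :: "'a::euclidean_space set"
  assumes "x \<in> f" "z \<in> f"
  shows "z - oproj (lin f) z = x - oproj (lin f) x"
proof -
  have W: "subspace (lin f)" using assms by (intro subspace_lin) auto
  have "oproj (lin f) (z - x) = z - x" using oproj_id[OF W diff_in_lin] assms by blast
  then show ?thesis using linear_diff[OF linear_oproj[OF W], of z x] by (simp add: algebra_simps)
qed

text \<open>All points of \<open>f\<close> have the same component orthogonal to
  \<open>lin f\<close>, so the definite description is meaningful and can be evaluated at any of
  them.\<close>

lemma perp_vertex_eq:
  fixes f :: "'a::euclidean_space set"
  assumes "x \<in> f"
  shows "perp_vertex f = x - oproj (lin f) x"
proof -
  have W: "subspace (lin f)" using assms by (intro subspace_lin) auto
  have "proj_perp f f = {x - oproj (lin f) x}"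
    unfolding proj_perp_def oproj_orth_compl[OF W] using oproj_eq_diff assms by auto
  then show ?thesis by (simp add: perp_vertex_def)
qed

lemma perp_vertex_in_orth_compl:
  fixes f :: "'a::euclidean_space set"
  assumes "f \<noteq> {}"
  shows "perp_vertex f \<in> orth_compl (lin f)"
proof -
  obtain x where "x \<in> f" using assms by blast
  then show ?thesis using perp_vertex_eq diff_oproj_in[OF subspace_lin[OF assms]] by metis
qed

lemma proj_par_self:
  fixes f :: "'a::euclidean_space set"
  shows "proj_par f f = (\<lambda>z. z - perp_vertex f) ` f"
  unfolding proj_par_def
proof (rule image_cong)
  fix z assume "z \<in> f"
  from perp_vertex_eq[OF this] show "oproj (lin f) z = z - perp_vertex f" by simp
qed simp

lemma lin_subset_feasible_dirs:
  fixes f :: "'a::euclidean_space set"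
  assumes "x \<in> rel_interior f"
  shows "lin f \<subseteq> feasible_dirs f x"
proof
  fix u assume "u \<in> lin f"
  then obtain a b where ab: "a \<in> affine hull f" "b \<in> affine hull f" "u = a - b" by (auto simp: lin_def)
  obtain e where e: "e > 0" "ball x e \<inter> affine hull f \<subseteq> f" and x: "x \<in> f"
    using assms by (auto simp: mem_rel_interior_ball)
  \<comment> \<open>The step has length at most \<open>e / 2\<close>; the added 1 avoids a zero
    denominator when \<open>u = 0\<close>.\<close>
  define \<epsilon> where "\<epsilon> = e / (2 * (norm u + 1))"
  have n: "norm u + 1 > 0" by (smt (verit) norm_ge_zero)
  then have "\<epsilon> > 0" using e(1) by (simp add: \<epsilon>_def)
  have "\<epsilon> * norm u \<le> \<epsilon> * (norm u + 1)" using \<open>\<epsilon> > 0\<close> by simp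
  also have "\<dots> = e / 2" using n by (simp add: \<epsilon>_def field_simps)
  finally have "x + \<epsilon> *\<^sub>R u \<in> ball x e" using e(1) \<open>\<epsilon> > 0\<close> by (simp add: dist_norm)
  moreover have "x + \<epsilon> *\<^sub>R u \<in> affine hull f"
    using mem_affine_3_minus[OF affine_affine_hull hull_inc[OF x] ab(1,2)] ab(3) by simp
  ultimately show "u \<in> feasible_dirs f x" using e \<open>\<epsilon> > 0\<close> by (auto simp: feasible_dirs_def)
qed

text \<open>At a relative interior point of \<open>f\<close> the cone of feasible directions absorbs
  \<open>lin f\<close>, so projecting it to the orthogonal complement is the same as intersecting it
  with the complement. The witness is the point selected in \<open>tangent_cone\<close>.\<close>

lemma transverse_cone0_eq:
  fixes q f :: "'a::euclidean_space set"
  assumes "convex q" "convex f" "f \<subseteq> q" "f \<noteq> {}"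
  shows "\<exists>x\<in>f. transverse_cone0 q f = feasible_dirs q x \<inter> orth_compl (lin f)"
proof
  define x where "x = (SOME x. x \<in> rel_interior f)"
  have "rel_interior f \<noteq> {}" using assms rel_interior_eq_empty by blast
  then have xr: "x \<in> rel_interior f" unfolding x_def by (simp add: some_in_eq)
  then show xf: "x \<in> f" using rel_interior_subset by blast
  then have xq: "x \<in> q" using assms by blast
  let ?W = "lin f" and ?K = "feasible_dirs q x"
  have W: "subspace ?W" using assms(4) by (rule subspace_lin)
  have WK: "?W \<subseteq> ?K"
    using lin_subset_feasible_dirs[OF xr] feasible_dirs_mono[OF assms(3), of x] by blast
  have "tangent_cone q f = (\<lambda>w. x + w) ` ?K"
    unfolding tangent_cone_def x_def[symmetric] Let_def
    using eventually_step_iff_feasible[OF assms(1) xq] by auto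
  then have "transverse_cone0 q f = (\<lambda>w. (x + w) - oproj ?W (x + w) - perp_vertex f) ` ?K"
    by (simp add: transverse_cone0_def transverse_cone_def proj_perp_def image_image oproj_orth_compl[OF W])
  also have "\<dots> = (\<lambda>w. w - oproj ?W w) ` ?K"
    by (rule image_cong) (auto simp: perp_vertex_eq[OF xf] linear_add[OF linear_oproj[OF W]])
  also have "\<dots> = ?K \<inter> orth_compl ?W"
  proof (intro equalityI subsetI)
    fix y assume "y \<in> (\<lambda>w. w - oproj ?W w) ` ?K"
    then obtain w where w: "w \<in> ?K" "y = w - oproj ?W w" by blast
    have "- oproj ?W w \<in> ?K" using oproj_in[OF W] subspace_neg[OF W] WK by blast
    then have "y \<in> ?K" using feasible_dirs_add[OF assms(1) xq w(1)] w(2) by fastforce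
    then show "y \<in> ?K \<inter> orth_compl ?W" using w(2) diff_oproj_in[OF W] by blast
  next
    fix y assume y: "y \<in> ?K \<inter> orth_compl ?W"
    have "oproj ?W y = 0" using oproj_add_orth[OF W subspace_0[OF W], of y] y by simp
    then show "y \<in> (\<lambda>w. w - oproj ?W w) ` ?K" using y by force
  qed
  finally show "transverse_cone0 q f = ?K \<inter> orth_compl ?W" .
qed

lemma lin_singleton: "lin {v} = {0}"
  by (auto simp: lin_def hull_same)

lemma orth_compl_zero: "orth_compl {0} = UNIV"
  by (auto simp: orth_compl_def)

lemma oproj_zero:
  fixes x :: "'a::euclidean_space"
  shows "oproj {0} x = 0"
  using oproj_in[of "{0}" x] by simp

lemma perp_vertex_singleton: "perp_vertex {v} = v"
  by (simp add: perp_vertex_eq[of v "{v}"] lin_singleton oproj_zero)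

lemma transverse_cone0_vertex:
  assumes "convex q" "v \<in> q"
  shows "transverse_cone0 q {v} = feasible_dirs q v"
  using transverse_cone0_eq[OF assms(1), of "{v}"] assms by (simp add: lin_singleton orth_compl_zero)

subsection \<open>Products of cones along a chain of faces\<close>

text \<open>The condition on \<xi> is left out because the geometry of the products is the same for
  all chains of nonempty faces.\<close>

definition face_chain :: "'a::euclidean_space set \<Rightarrow> 'a set list \<Rightarrow> bool" where
  "face_chain p hs \<longleftrightarrow> hs \<noteq> [] \<and> sorted_wrt (\<subset>) hs \<and> (\<forall>h\<in>set hs. h face_of p \<and> h \<noteq> {})"

text \<open>Induction along the chain: the cone of \<open>h\<close> in the next face
  \<open>h'\<close> lies in \<open>lin h'\<close>, and the product of the later cones lies in its
  orthogonal complement. The sum is thus an orthogonal product. Membership of 0 provides the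
  nonemptiness required by \<open>brion_product\<close>.\<close>

lemma chain_cones_product:
  fixes p :: "'a::euclidean_space set"
  assumes "polytope p" "face_chain p hs"
  shows "polyhedron (msum (chain_cones p hs)) \<and> 0 \<in> msum (chain_cones p hs) \<and>
    msum (chain_cones p hs) \<subseteq> orth_compl (lin (hd hs))"
  using assms(2)
proof (induction hs)
  case Nil
  then show ?case by (simp add: face_chain_def)
next
  case (Cons h hs)
  have h: "h face_of p" "h \<noteq> {}" using Cons.prems by (auto simp: face_chain_def)
  have cp: "convex p" and ch: "convex h"
    using assms(1) h polytope_imp_convex face_of_imp_convex by auto
  show ?case
  proof (cases hs)
    case Nil
    obtain x where x: "x \<in> h" "transverse_cone0 p h = feasible_dirs p x \<inter> orth_compl (lin h)"
      using transverse_cone0_eq[OF cp ch face_of_imp_subset[OF h(1)] h(2)] by blast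
    have xp: "x \<in> p" using x h face_of_imp_subset by blast
    have "polyhedron (feasible_dirs p x \<inter> orth_compl (lin h))"
      using polyhedron_feasible_dirs[OF polytope_imp_polyhedron[OF assms(1)] xp]
      by (simp add: affine_imp_polyhedron subspace_imp_affine subspace_orth_compl)
    moreover have "0 \<in> feasible_dirs p x \<inter> orth_compl (lin h)"
      using zero_in_feasible_dirs[OF xp] subspace_0[OF subspace_orth_compl] by blast
    ultimately show ?thesis using x(2) Nil by (auto simp: Int_def)
  next
    case (Cons h' hs')
    have h': "h' face_of p" "h' \<noteq> {}" "h \<subset> h'" and chain: "face_chain p hs"
      using Cons.prems Cons by (auto simp: face_chain_def)
    have ph': "polytope h'" using h'(1) assms(1) face_of_polytope_polytope by blast
    let ?W = "lin h'" and ?C = "msum (chain_cones p hs)" and ?T = "transverse_cone0 h' h"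
    have W: "subspace ?W" using h'(2) by (rule subspace_lin)
    have C: "polyhedron ?C" "0 \<in> ?C" "?C \<subseteq> orth_compl ?W" using Cons.IH[OF chain] Cons by auto
    obtain x where x: "x \<in> h" "?T = feasible_dirs h' x \<inter> orth_compl (lin h)"
      using transverse_cone0_eq[OF polytope_imp_convex[OF ph'] ch _ h(2)] h'(3) by blast
    have xh': "x \<in> h'" using x h' by blast
    have T: "polyhedron ?T" unfolding x(2)
      using polyhedron_feasible_dirs[OF polytope_imp_polyhedron[OF ph'] xh']
      by (simp add: affine_imp_polyhedron subspace_imp_affine subspace_orth_compl)
    have T0: "0 \<in> ?T" unfolding x(2)
      using zero_in_feasible_dirs[OF xh'] subspace_0[OF subspace_orth_compl] by blast
    have TW: "?T \<subseteq> ?W"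
      using feasible_dirs_subset_subspace[OF W diff_in_lin] xh' x(2) by blast
    have eq: "msum (chain_cones p (h # hs)) = {a + b | a b. a \<in> ?T \<and> b \<in> ?C}"
      using Cons by simp
    have "polyhedron (msum (chain_cones p (h # hs)))"
      unfolding eq orth_sum_eq_preimage[OF W TW C(3)]
      using polyhedron_orth_product[OF W T C(1), of 0] by simp
    moreover have "0 \<in> msum (chain_cones p (h # hs))"
      unfolding eq using T0 C(2) by force
    moreover have "msum (chain_cones p (h # hs)) \<subseteq> orth_compl (lin h)"
      unfolding eq using x(2) C(3) orth_compl_antimono[OF lin_mono, of h h'] h'(3)
        subspace_add[OF subspace_orth_compl] by blast
    ultimately show ?thesis by simp
  qed
qed

text \<open>The contribution of one chain to the right-hand side of the theorem, without its
  sign.\<close>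

definition chain_term :: "'a::euclidean_space set \<Rightarrow> 'a set list \<Rightarrow> 'a \<Rightarrow> real" where
  "chain_term p hs = vprod_face (hd hs) (proj_par (hd hs) (hd hs))
     (\<lambda>y. indicator (msum (chain_cones p hs)) (y - perp_vertex (hd hs)))"

lemma chain_term_eq:
  assumes "hd hs \<noteq> {}"
  shows "chain_term p hs x = indicator (proj_par (hd hs) (hd hs)) (oproj (lin (hd hs)) x) *
    indicator (msum (chain_cones p hs)) (x - oproj (lin (hd hs)) x - perp_vertex (hd hs))"
  by (simp add: chain_term_def vprod_face_def oproj_orth_compl[OF subspace_lin[OF assms]])

lemma chain_term_vertex_head:
  assumes "hd hs = {v}"
  shows "chain_term p hs x = indicator (msum (chain_cones p hs)) (x - v)"
  using assms by (simp add: chain_term_eq lin_singleton oproj_zero proj_par_def perp_vertex_singleton)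

lemma chain_term_vertex:
  assumes "convex p" "v \<in> p"
  shows "chain_term p [{v}] x = indicator (point_cone p v) x"
  by (simp add: chain_term_vertex_head transverse_cone0_vertex[OF assms] point_cone_def indicator_def)

text \<open>Splitting along \<open>lin g\<close> shows that, compared with
  \<open>chain_term_eq\<close> for \<open>hs\<close>, only the first factor changes: the projected
  face is replaced by its tangent cone at the image of \<open>v\<close>. This is the form in which
  Brion's relation applies.\<close>

lemma chain_term_vertex_Cons:
  assumes "polytope p" and hs: "face_chain p hs" and v: "v \<in> hd hs"
  defines "g \<equiv> hd hs"
  shows "chain_term p ({v} # hs) x =
    indicator (point_cone (proj_par g g) (v - perp_vertex g)) (oproj (lin g) x) *
    indicator (msum (chain_cones p hs)) (x - oproj (lin g) x - perp_vertex g)"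
proof -
  let ?W = "lin g" and ?C = "msum (chain_cones p hs)"
  have g: "g face_of p" "g \<noteq> {}" and hsg: "hs = g # tl hs"
    using hs by (auto simp: face_chain_def g_def)
  have cg: "convex g" using g face_of_imp_convex by blast
  have W: "subspace ?W" using g(2) by (rule subspace_lin)
  have vg: "v \<in> g" using v by (simp add: g_def)
  have KW: "feasible_dirs g v \<subseteq> ?W" using feasible_dirs_subset_subspace[OF W diff_in_lin] vg by blast
  have CW: "?C \<subseteq> orth_compl ?W" using chain_cones_product[OF assms(1) hs] by (simp add: g_def)
  have "chain_cones p ({v} # hs) = transverse_cone0 g {v} # chain_cones p hs"
    by (subst (1 2) hsg) simp
  then have "msum (chain_cones p ({v} # hs)) = {a + b | a b. a \<in> feasible_dirs g v \<and> b \<in> ?C}"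
    by (simp add: transverse_cone0_vertex[OF cg vg])
  also have "\<dots> = {y. oproj ?W y \<in> feasible_dirs g v \<and> y - oproj ?W y \<in> ?C}"
    by (rule orth_sum_eq_preimage[OF W KW CW])
  finally have "x - v \<in> msum (chain_cones p ({v} # hs)) \<longleftrightarrow>
      oproj ?W (x - v) \<in> feasible_dirs g v \<and> x - v - oproj ?W (x - v) \<in> ?C"
    by simp
  moreover have "oproj ?W (x - v) = oproj ?W x - (v - perp_vertex g)"
    by (simp add: linear_diff[OF linear_oproj[OF W]] perp_vertex_eq[OF vg])
  moreover have "feasible_dirs g v = feasible_dirs (proj_par g g) (v - perp_vertex g)"
    by (simp add: proj_par_self feasible_dirs_translation)
  ultimately show ?thesis
    by (auto simp: chain_term_vertex_head point_cone_def indicator_def algebra_simps)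
qed

text \<open>\<open>brion_product\<close> for the projected head, with the cones of the chain as
  second factor. The projected head is a translate of \<open>g\<close>, which matches their extreme
  points.\<close>

lemma chain_term_head_expansion:
  assumes "polytope p" and hs: "face_chain p hs"
  shows "(\<lambda>x. chain_term p hs x - (\<Sum>v\<in>{v. v extreme_point_of hd hs}. chain_term p ({v} # hs) x))
    \<in> line_span"
proof -
  define g where "g = hd hs"
  let ?q = "proj_par g g" and ?a = "perp_vertex g" and ?C = "msum (chain_cones p hs)"
  have g: "g face_of p" "g \<noteq> {}" using hs by (auto simp: face_chain_def g_def)
  have W: "subspace (lin g)" using g(2) by (rule subspace_lin)
  have q: "?q = (\<lambda>z. z - ?a) ` g" by (rule proj_par_self)
  have "polytope g" using g assms(1) face_of_polytope_polytope by blast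
  then have "polytope ?q" using q polytope_translation_eq[of "- ?a" g] by simp
  moreover have "?q \<noteq> {}" using q g by simp
  moreover have "?q \<subseteq> lin g" unfolding proj_par_def using oproj_in[OF W] by blast
  moreover have "polyhedron ?C" "?C \<noteq> {}" "?C \<subseteq> orth_compl (lin g)"
    using chain_cones_product[OF assms] by (auto simp: g_def)
  ultimately have "(\<lambda>x. indicator ?q (oproj (lin g) x) * indicator ?C (x - oproj (lin g) x - ?a) -
    (\<Sum>v\<in>{v. v extreme_point_of ?q}. indicator (point_cone ?q v) (oproj (lin g) x) *
       indicator ?C (x - oproj (lin g) x - ?a))) \<in> line_span"
    using brion_product[OF W _ _ _ _ _ _ perp_vertex_in_orth_compl[OF g(2)]] by blast
  moreover have "{v. v extreme_point_of ?q} = (\<lambda>z. z - ?a) ` {v. v extreme_point_of g}"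
    unfolding q by (rule extreme_points_of_translation_subtract)
  moreover have "chain_term p ({v} # hs) x = indicator (point_cone ?q (v - ?a)) (oproj (lin g) x) *
      indicator ?C (x - oproj (lin g) x - ?a)" if "v extreme_point_of g" for v x
    using chain_term_vertex_Cons[OF assms, of v x] that by (simp add: g_def extreme_point_of_def)
  ultimately show ?thesis
    using g(2) by (simp add: chain_term_eq sum.reindex inj_on_def flip: g_def)
qed

subsection \<open>Cancellation between chains\<close>

text \<open>With \<open>extreme_point_of_chain_head\<close>, this makes prepending and deleting a
  vertex inverse operations; a head with more than one point keeps the inclusion strict.\<close>

lemma face_chain_Cons_vertex:
  assumes "face_chain p hs" "v extreme_point_of hd hs" "\<nexists>u. hd hs = {u}"
  shows "face_chain p ({v} # hs)"
proof -
  obtain g hs' where hs: "hs = g # hs'" using assms(1) by (cases hs) (auto simp: face_chain_def)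
  have vg: "{v} face_of g" using assms(2) hs by (simp add: face_of_singleton)
  then have "{v} \<subset> g" using assms(3) hs face_of_imp_subset by fastforce
  moreover have "{v} face_of p" using vg assms(1) hs face_of_trans by (auto simp: face_chain_def)
  ultimately show ?thesis using assms(1) hs by (auto simp: face_chain_def)
qed

lemma extreme_point_of_chain_head:
  assumes "face_chain p ({v} # g # hs)"
  shows "v extreme_point_of g" "\<nexists>u. g = {u}"
proof -
  have "{v} face_of p" "g face_of p" "{v} \<subset> g" using assms by (auto simp: face_chain_def)
  then have "{v} face_of g" using face_of_subset face_of_imp_subset by blast
  then show "v extreme_point_of g" by (simp add: face_of_singleton)
  show "\<nexists>u. g = {u}" using \<open>{v} \<subset> g\<close> by auto
qed

text \<open>The head is free here, unlike in \<open>xi_chains\<close>, so the double sum over faces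
  and chains becomes a single sum.\<close>

definition xi_face_chains :: "'a::euclidean_space set \<Rightarrow> ('a \<Rightarrow> complex) \<Rightarrow> 'a set list set" where
  "xi_face_chains p \<xi> = {hs. face_chain p hs \<and> (\<forall>h\<in>set hs. xi_const_face p \<xi> h)}"

lemma finite_xi_const_faces: "polytope p \<Longrightarrow> finite {g. xi_const_face p \<xi> g}"
  by (rule finite_subset[OF _ finite_polytope_faces]) (auto simp: xi_const_face_def)

lemma finite_xi_face_chains:
  assumes "polytope p"
  shows "finite (xi_face_chains p \<xi>)"
proof (rule finite_subset)
  have "distinct hs" if "sorted_wrt (\<subset>) hs" for hs :: "'a set list"
    using that by (induction hs) auto
  then show "xi_face_chains p \<xi> \<subseteq> {hs. set hs \<subseteq> {g. xi_const_face p \<xi> g} \<and> distinct hs}"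
    by (auto simp: xi_face_chains_def face_chain_def)
  show "finite {hs. set hs \<subseteq> {g. xi_const_face p \<xi> g} \<and> distinct hs}"
    using finite_subset_distinct[OF finite_xi_const_faces[OF assms]] .
qed

lemma sum_chain_terms:
  assumes "polytope p"
  shows "(\<Sum>g\<in>{g. xi_const_face p \<xi> g}. vprod_face g (proj_par g g) (LC p \<xi> g) x) =
    (\<Sum>hs\<in>xi_face_chains p \<xi>. (- 1) ^ (length hs - 1) * chain_term p hs x)"
proof -
  have chains: "xi_chains p \<xi> g = {hs \<in> xi_face_chains p \<xi>. hd hs = g}" for g
    by (auto simp: xi_chains_def xi_face_chains_def face_chain_def xi_const_face_def)
  have "vprod_face g (proj_par g g) (LC p \<xi> g) x =
      (\<Sum>hs\<in>{hs \<in> xi_face_chains p \<xi>. hd hs = g}. (- 1) ^ (length hs - 1) * chain_term p hs x)" for g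
    unfolding vprod_face_def LC_def shifted_LC_def chains sum_distrib_left
    by (rule sum.cong) (auto simp: chain_term_def vprod_face_def)
  then have "(\<Sum>g\<in>{g. xi_const_face p \<xi> g}. vprod_face g (proj_par g g) (LC p \<xi> g) x) =
      (\<Sum>g\<in>{g. xi_const_face p \<xi> g}. \<Sum>hs\<in>{hs \<in> xi_face_chains p \<xi>. hd hs = g}.
        (- 1) ^ (length hs - 1) * chain_term p hs x)"
    by simp
  also have "\<dots> = (\<Sum>hs\<in>xi_face_chains p \<xi>. (- 1) ^ (length hs - 1) * chain_term p hs x)"
    using finite_xi_face_chains[OF assms] finite_xi_const_faces[OF assms]
    by (rule sum.group) (auto simp: xi_face_chains_def face_chain_def)
  finally show ?thesis .
qed

text \<open>A functional is constant on a single point, so prepending a vertex never leaves the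
  \<xi>-constant chains. Deleting a vertex at the head leads to \<open>D\<close>, unless nothing
  else remains.\<close>

lemma xi_face_chains_partition:
  fixes p :: "'a::euclidean_space set" and \<xi> :: "'a \<Rightarrow> complex"
  defines "D \<equiv> {hs \<in> xi_face_chains p \<xi>. \<nexists>u. hd hs = {u}}"
  shows "xi_face_chains p \<xi> = (\<lambda>v. [{v}]) ` {v. v extreme_point_of p} \<union>
    (\<lambda>(hs, v). {v} # hs) ` (SIGMA hs:D. {v. v extreme_point_of hd hs}) \<union> D"
    (is "_ = ?A \<union> ?B \<union> D")
proof (intro equalityI subsetI)
  fix ks assume ks: "ks \<in> xi_face_chains p \<xi>"
  then obtain k hs where k: "ks = k # hs" by (cases ks) (auto simp: xi_face_chains_def face_chain_def)
  show "ks \<in> ?A \<union> ?B \<union> D"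
  proof (cases "\<exists>v. k = {v}")
    case True
    then obtain v where v: "k = {v}" by blast
    show ?thesis
    proof (cases hs)
      case Nil
      have "v extreme_point_of p"
        using ks k v by (simp add: xi_face_chains_def face_chain_def face_of_singleton)
      then show ?thesis using k v Nil by blast
    next
      case (Cons g hs')
      have fc: "face_chain p ({v} # g # hs')" using ks k v Cons by (simp add: xi_face_chains_def)
      then have "hs \<in> D" using extreme_point_of_chain_head(2)[OF fc] ks k Cons
        by (auto simp: D_def xi_face_chains_def face_chain_def)
      then show ?thesis using extreme_point_of_chain_head(1)[OF fc] k v Cons by force
    qed
  qed (use ks k in \<open>auto simp: D_def\<close>)
next
  fix ks assume "ks \<in> ?A \<union> ?B \<union> D"
  then consider v where "v extreme_point_of p" "ks = [{v}]"
    | hs v where "hs \<in> D" "v extreme_point_of hd hs" "ks = {v} # hs" | "ks \<in> D"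
    by auto
  then show "ks \<in> xi_face_chains p \<xi>"
  proof cases
    case 1
    then show ?thesis
      by (auto simp: xi_face_chains_def face_chain_def xi_const_face_def face_of_singleton)
  next
    case 2
    then have "face_chain p ({v} # hs)"
      by (intro face_chain_Cons_vertex) (auto simp: D_def xi_face_chains_def)
    then show ?thesis
      using 2 by (auto simp: D_def xi_face_chains_def face_chain_def xi_const_face_def)
  qed (auto simp: D_def)
qed

lemma sum_xi_face_chains:
  fixes p :: "'a::euclidean_space set" and \<xi> :: "'a \<Rightarrow> complex" and t :: "'a set list \<Rightarrow> real"
  assumes "polytope p"
  defines "D \<equiv> {hs \<in> xi_face_chains p \<xi>. \<nexists>u. hd hs = {u}}"
  shows "(\<Sum>hs\<in>xi_face_chains p \<xi>. (- 1) ^ (length hs - 1) * t hs) =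
    (\<Sum>v\<in>{v. v extreme_point_of p}. t [{v}]) +
    (\<Sum>hs\<in>D. (- 1) ^ (length hs - 1) * (t hs - (\<Sum>v\<in>{v. v extreme_point_of hd hs}. t ({v} # hs))))"
proof -
  let ?E = "\<lambda>q. {v::'a. v extreme_point_of q}" and ?s = "\<lambda>hs. (- 1) ^ (length hs - 1) * t hs"
  let ?A = "(\<lambda>v. [{v}]) ` ?E p" and ?B = "(\<lambda>(hs, v). {v} # hs) ` (SIGMA hs:D. ?E (hd hs))"
  have part: "xi_face_chains p \<xi> = ?A \<union> ?B \<union> D" unfolding D_def by (rule xi_face_chains_partition)
  have fin: "finite (?A \<union> ?B \<union> D)" using finite_xi_face_chains[OF assms(1), of \<xi>] part by simp
  have nonempty: "hs \<noteq> []" if "hs \<in> D" for hs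
    using that by (auto simp: D_def xi_face_chains_def face_chain_def)
  have finE: "finite (?E (hd hs))" if "hs \<in> D" for hs
  proof -
    have "hd hs face_of p" using that by (auto simp: D_def xi_face_chains_def face_chain_def)
    then show ?thesis
      using assms(1) face_of_polytope_polytope polytope_imp_polyhedron finite_polyhedron_extreme_points
      by blast
  qed
  have "sum ?s (xi_face_chains p \<xi>) = sum ?s (?A \<union> ?B) + sum ?s D"
    unfolding part using fin by (intro sum.union_disjoint) (auto simp: D_def)
  also have "sum ?s (?A \<union> ?B) = sum ?s ?A + sum ?s ?B"
    using fin nonempty by (intro sum.union_disjoint) auto
  also have "sum ?s ?A = (\<Sum>v\<in>?E p. t [{v}])"
    by (subst sum.reindex) (auto simp: inj_on_def)
  also have "sum ?s ?B = (\<Sum>(hs, v)\<in>(SIGMA hs:D. ?E (hd hs)). (- 1) ^ length hs * t ({v} # hs))"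
    by (subst sum.reindex) (auto simp: inj_on_def case_prod_beta)
  also have "\<dots> = (\<Sum>hs\<in>D. \<Sum>v\<in>?E (hd hs). (- 1) ^ length hs * t ({v} # hs))"
    using fin finE by (intro sum.Sigma[symmetric]) auto
  also have "\<dots> = (\<Sum>hs\<in>D. - ((- 1) ^ (length hs - 1) * (\<Sum>v\<in>?E (hd hs). t ({v} # hs))))"
  proof (rule sum.cong)
    fix hs assume "hs \<in> D"
    \<comment> \<open>Chains are nonempty, so the truncated subtraction in the exponent is exact and
      prepending a vertex flips the sign.\<close>
    then obtain n where "length hs = Suc n" using nonempty by (cases hs) auto
    then show "(\<Sum>v\<in>?E (hd hs). (- 1) ^ length hs * t ({v} # hs)) =
        - ((- 1) ^ (length hs - 1) * (\<Sum>v\<in>?E (hd hs). t ({v} # hs)))"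
      by (simp add: sum_distrib_left sum_negf)
  qed simp
  finally show ?thesis
    by (simp add: right_diff_distrib sum_subtractf sum_negf)
qed

theorem mainTheorem2:
  fixes p :: "'a::euclidean_space set" and \<xi> :: "'a \<Rightarrow> complex"
  assumes "polytope p" and "linear \<xi>"
  shows "vequiv (indicator p)
           (\<lambda>x. \<Sum>g\<in>{g. xi_const_face p \<xi> g}.
                  vprod_face g (proj_par g g) (LC p \<xi> g) x)"
proof (cases "p = {}")
  case True
  then have "{g. xi_const_face p \<xi> g} = {}" by (auto simp: xi_const_face_def)
  with True show ?thesis by (intro vequivI) (simp add: line_span.zero)
next
  case False
  let ?D = "{hs \<in> xi_face_chains p \<xi>. \<nexists>u. hd hs = {u}}"
  have cone: "chain_term p [{v}] x = indicator (point_cone p v) x" if "v extreme_point_of p" for v x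
    using that chain_term_vertex[OF polytope_imp_convex[OF assms(1)]]
    by (simp add: extreme_point_of_def)
  \<comment> \<open>Taking \<open>UNIV\<close> and \<open>{0}\<close> as the orthogonal factors
    makes the product trivial and leaves Brion's theorem for \<open>p\<close>.\<close>
  have brion: "(\<lambda>x. indicator p x - (\<Sum>v\<in>{v. v extreme_point_of p}. chain_term p [{v}] x)) \<in> line_span"
    using brion_product[of UNIV p "{0}" 0] assms(1) False affine_imp_polyhedron[OF affine_sing[of 0]]
    by (simp add: cone oproj_id subspace_0 subspace_orth_compl)
  \<comment> \<open>By \<open>sum_xi_face_chains\<close> this function is exactly the difference of
    the two sides; each bracket in the second sum is negligible by the expansion of the
    head.\<close>
  have "(\<lambda>x. (indicator p x - (\<Sum>v\<in>{v. v extreme_point_of p}. chain_term p [{v}] x)) +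
     (\<Sum>hs\<in>?D. (- ((- 1) ^ (length hs - 1))) *
       (chain_term p hs x - (\<Sum>v\<in>{v. v extreme_point_of hd hs}. chain_term p ({v} # hs) x)))) \<in> line_span"
    by (intro line_span_add[OF brion] line_span_sum line_span_scale chain_term_head_expansion[OF assms(1)])
      (auto simp: xi_face_chains_def)
  then show ?thesis
    unfolding sum_chain_terms[OF assms(1)] sum_xi_face_chains[OF assms(1)]
    by (intro vequivI) (simp add: sum_negf diff_diff_eq)
qed

end
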